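(* Let $Y$ be a Banach space and let $\omega:(0,\infty)\to(0,\infty)$ be a non-decreasing function such that $\lim_{t\to 0}\omega(t)=0$, $\lim_{t\to\infty}\omega(t)=\infty$, $\lim_{t\to 0}t/\omega(t)=0$, and, for some constant $C_{\mathrm{db}}>1$, $\omega(2t)\le C_{\mathrm{db}}\,\omega(t)$ for all $t\in(0,\infty)$. Then $$\dot{\mathrm{VC}}^{0,\omega}(\mathbb R^n,Y)=\overline{C^\infty_c(\mathbb R^n,Y)}^{\,\dot C^{0,\omega}(\mathbb R^n,Y)}.$$
   Context: Here $n\ge1$ and $X=\mathbb R^n$ carries the Euclidean norm. $\dot C^{0,\omega}(X,Y)$ is the set of $f:X\to Y$ with $\|f\|_{\dot C^{0,\omega}(X,Y)}:=\sup_{x\ne y}\frac{\|f(x)-f(y)\|_Y}{\omega(\|x-y\|_X)}<\infty$. For $x\neq y$ put $\mathrm{osc}^\omega_{(x,y)}(f)=\frac{\|f(x)-f(y)\|_Y}{\omega(\|x-y\|_X)}$, and for $\delta>0$ put $\mathrm{osc}^\omega_\delta(f)=\sup\{\mathrm{osc}^\omega_{(x,y)}(f): x,y\in X,\ \|x-y\|_X=\delta\}$. Define $\dot{\mathrm{VC}}^{0,\omega}_{\mathrm{small}}(X,Y)=\{f\in\dot C^{0,\omega}(X,Y):\lim_{\delta\to0}\mathrm{osc}^\omega_\delta(f)=0\}$, $\dot{\mathrm{VC}}^{0,\omega}_{\mathrm{large}}(X,Y)=\{f\in\dot C^{0,\omega}(X,Y):\lim_{\delta\to\infty}\mathrm{osc}^\omega_\delta(f)=0\}$,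 $\dot{\mathrm{VC}}^{0,\omega}_{\mathrm{far}}(X,Y)=\{f\in\dot C^{0,\omega}(X,Y):\lim_{\delta\to\infty}\sup_{x\ne y,\ \min(\|x\|,\|y\|)>\delta}\mathrm{osc}^\omega_{(x,y)}(f)=0\}$, and $\dot{\mathrm{VC}}^{0,\omega}(X,Y)$ as the intersection of these three sets. $C^\infty_c(\mathbb R^n,Y)$ is the set of compactly supported $C^\infty$ maps $\mathbb R^n\to Y$. For $\mathcal C\subset\dot C^{0,\omega}(X,Y)$, $\overline{\mathcal C}^{\,\dot C^{0,\omega}(X,Y)}$ is the set of $f\in\dot C^{0,\omega}(X,Y)$ for which there is a sequence $(f_n)\subset\mathcal C$ with $\|f_n-f\|_{\dot C^{0,\omega}(X,Y)}\to0$. *)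

theory Defs
  imports "HOL-Analysis.Analysis"
begin

text \<open>
  A modulus \<open>\<omega> : (0,\<infinity>) \<rightarrow> (0,\<infinity>)\<close> is represented by a function on all reals, of which only the
  values at positive arguments are used. Suprema that may be infinite are taken in
  \<^typ>\<open>ennreal\<close>; for a modulus \<open>\<omega>\<close> that is positive on \<open>(0,\<infinity>)\<close> the quotients below are
  nonnegative, so the coercion \<^const>\<open>ennreal\<close> does not truncate them.
\<close>

definition osc_pair ::
  "(real \<Rightarrow> real) \<Rightarrow> ('a::real_normed_vector \<Rightarrow> 'b::real_normed_vector) \<Rightarrow> 'a \<Rightarrow> 'a \<Rightarrow> real" where
  "osc_pair \<omega> f x y = norm (f x - f y) / \<omega> (norm (x - y))"

definition hoelder_seminorm ::
  "(real \<Rightarrow> real) \<Rightarrow> ('a::real_normed_vector \<Rightarrow> 'b::real_normed_vector) \<Rightarrow> ennreal" where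
  "hoelder_seminorm \<omega> f = (SUP (x, y) \<in> {(x, y). x \<noteq> y}. ennreal (osc_pair \<omega> f x y))"

definition hoelder_space ::
  "(real \<Rightarrow> real) \<Rightarrow> ('a::real_normed_vector \<Rightarrow> 'b::real_normed_vector) set" where
  "hoelder_space \<omega> = {f. hoelder_seminorm \<omega> f < \<infinity>}"

definition osc_scale ::
  "(real \<Rightarrow> real) \<Rightarrow> ('a::real_normed_vector \<Rightarrow> 'b::real_normed_vector) \<Rightarrow> real \<Rightarrow> ennreal" where
  "osc_scale \<omega> f \<delta> = (SUP (x, y) \<in> {(x, y). norm (x - y) = \<delta>}. ennreal (osc_pair \<omega> f x y))"

definition osc_far ::
  "(real \<Rightarrow> real) \<Rightarrow> ('a::real_normed_vector \<Rightarrow> 'b::real_normed_vector) \<Rightarrow> real \<Rightarrow> ennreal" where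
  "osc_far \<omega> f \<delta> =
     (SUP (x, y) \<in> {(x, y). x \<noteq> y \<and> min (norm x) (norm y) > \<delta>}. ennreal (osc_pair \<omega> f x y))"

definition VC_small ::
  "(real \<Rightarrow> real) \<Rightarrow> ('a::real_normed_vector \<Rightarrow> 'b::real_normed_vector) set" where
  "VC_small \<omega> = {f \<in> hoelder_space \<omega>. (osc_scale \<omega> f \<longlongrightarrow> 0) (at_right 0)}"

definition VC_large ::
  "(real \<Rightarrow> real) \<Rightarrow> ('a::real_normed_vector \<Rightarrow> 'b::real_normed_vector) set" where
  "VC_large \<omega> = {f \<in> hoelder_space \<omega>. (osc_scale \<omega> f \<longlongrightarrow> 0) at_top}"

definition VC_far ::
  "(real \<Rightarrow> real) \<Rightarrow> ('a::real_normed_vector \<Rightarrow> 'b::real_normed_vector) set" where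
  "VC_far \<omega> = {f \<in> hoelder_space \<omega>. (osc_far \<omega> f \<longlongrightarrow> 0) at_top}"

definition VC ::
  "(real \<Rightarrow> real) \<Rightarrow> ('a::real_normed_vector \<Rightarrow> 'b::real_normed_vector) set" where
  "VC \<omega> = VC_small \<omega> \<inter> VC_large \<omega> \<inter> VC_far \<omega>"

text \<open>
  \<open>C\<^sup>k\<close> maps on a finite-dimensional space, by recursion on \<open>k\<close>: the derivative is
  differentiated again through its directional components \<open>x \<mapsto> Df(x) v\<close>, which avoids
  iterating operator-valued derivatives, whose types change with the order. As the domain is
  finite-dimensional, continuity of \<open>x \<mapsto> Df(x) v\<close> for every \<open>v\<close> is continuity of \<open>Df\<close>.
\<close>

primrec C_k :: "nat \<Rightarrow> ('a::euclidean_space \<Rightarrow> 'b::real_normed_vector) \<Rightarrow> bool" where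
  "C_k 0 f \<longleftrightarrow> continuous_on UNIV f"
| "C_k (Suc k) f \<longleftrightarrow>
     (\<forall>x. f differentiable (at x)) \<and> (\<forall>v. C_k k (\<lambda>x. frechet_derivative f (at x) v))"

definition Cc_infinity :: "('a::euclidean_space \<Rightarrow> 'b::real_normed_vector) set" where
  "Cc_infinity = {f. (\<forall>k. C_k k f) \<and> compact (closure (support_on UNIV f))}"

definition hoelder_closure ::
  "(real \<Rightarrow> real) \<Rightarrow> ('a::real_normed_vector \<Rightarrow> 'b::real_normed_vector) set \<Rightarrow> ('a \<Rightarrow> 'b) set" where
  "hoelder_closure \<omega> \<C> = {f \<in> hoelder_space \<omega>.
     \<exists>g :: nat \<Rightarrow> 'a \<Rightarrow> 'b. (\<forall>k. g k \<in> \<C>) \<and>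
       (\<lambda>k. hoelder_seminorm \<omega> (\<lambda>x. g k x - f x)) \<longlonglongrightarrow> 0}"

end

theory Submission
  imports Defs "HOL-Computational_Algebra.Polynomial"
begin

text \<open>
  For the inclusion of \<open>VC\<close> in the closure, \<open>f\<close> is first cut off by multiplying \<open>f - f 0\<close> with a
  piecewise linear function that decreases from 1 to 0 on \<open>R \<le> \<bar>x\<bar> \<le> 2 R\<close>, and the result \<open>F\<close> is
  then replaced by \<open>\<Sum>\<^sub>j F (\<eta> j) \<Phi> (x / \<eta> - j)\<close>, the sum being over the integer lattice and the
  translates of \<open>\<Phi>\<close> being a smooth partition of unity. As \<open>\<omega> t / t\<close> need not be almost decreasing,
  an oscillation over a distance \<open>r\<close> is never bounded by \<open>\<omega> r\<close> alone: it is broken into about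
  \<open>r / t\<close> steps of length at most \<open>t\<close> and bounded by \<open>(r / t + 1) \<epsilon> \<omega> t\<close>, and the factor \<open>r / t\<close> is
  absorbed by the Lipschitz estimate of the cut-off or of \<open>\<Phi>\<close>. The reverse inclusion holds because
  the three vanishing conditions are stable under limits in the seminorm.
\<close>

subsection \<open>Smooth functions\<close>

text \<open>Derivatives are unique, so any explicitly computed derivative can stand in for the
  choice \<open>frechet_derivative\<close>. The inductions on the order below enter the recursion
  through this rule.\<close>

lemma C_k_SucI:
  assumes "\<And>x. (f has_derivative f' x) (at x)" and "\<And>v. C_k k (\<lambda>x. f' x v)"
  shows "C_k (Suc k) f"
proof -
  have "frechet_derivative f (at x) = f' x" for x
    using frechet_derivative_at[OF assms(1)[of x]] by simp
  moreover have "f differentiable (at x)" for x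
    using assms(1)[of x] by (auto simp: differentiable_def)
  ultimately show ?thesis
    using assms(2) by simp
qed

lemma C_k_Suc_has_derivative:
  assumes "C_k (Suc k) f"
  shows "(f has_derivative frechet_derivative f (at x)) (at x)"
  using assms frechet_derivative_works[of f "at x"] by simp

text \<open>The recursion does not nest the orders by definition. The product rule needs the
  nesting, since its terms keep one factor undifferentiated.\<close>

lemma C_k_Suc_imp_C_k:
  "C_k (Suc k) f \<Longrightarrow> C_k k f"
proof (induction k arbitrary: f)
  case 0
  then show ?case
    by (auto intro!: continuous_at_imp_continuous_on differentiable_imp_continuous_within)
next
  case (Suc k)
  have "C_k (Suc k) (\<lambda>x. frechet_derivative f (at x) v)" for v
    using Suc.prems C_k.simps(2)[of "Suc k" f] by blast
  then show ?case
    using Suc by simp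
qed

lemma C_k_const: "C_k k (\<lambda>x. c)"
proof (induction k arbitrary: c)
  case (Suc k)
  show ?case
    by (rule C_k_SucI[where f'="\<lambda>x v. 0"]) (auto intro: Suc derivative_eq_intros)
qed auto

lemma C_k_add: "C_k k f \<Longrightarrow> C_k k g \<Longrightarrow> C_k k (\<lambda>x. f x + g x)"
proof (induction k arbitrary: f g)
  case (Suc k)
  show ?case
  proof (rule C_k_SucI)
    show "((\<lambda>x. f x + g x) has_derivative
        (\<lambda>v. frechet_derivative f (at x) v + frechet_derivative g (at x) v)) (at x)" for x
      using Suc.prems by (intro has_derivative_add C_k_Suc_has_derivative)
    show "C_k k (\<lambda>x. frechet_derivative f (at x) v + frechet_derivative g (at x) v)" for v
      using Suc.prems by (intro Suc.IH) simp_all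
  qed
qed (auto intro: continuous_intros)

lemma C_k_scaleR:
  fixes f :: "'a::euclidean_space \<Rightarrow> real"
  shows "C_k k f \<Longrightarrow> C_k k g \<Longrightarrow> C_k k (\<lambda>x. f x *\<^sub>R g x)"
proof (induction k arbitrary: f g)
  case (Suc k)
  show ?case
  proof (rule C_k_SucI)
    show "((\<lambda>x. f x *\<^sub>R g x) has_derivative
        (\<lambda>v. f x *\<^sub>R frechet_derivative g (at x) v + frechet_derivative f (at x) v *\<^sub>R g x)) (at x)" for x
      using Suc.prems by (intro has_derivative_scaleR C_k_Suc_has_derivative)
    show "C_k k (\<lambda>x. f x *\<^sub>R frechet_derivative g (at x) v + frechet_derivative f (at x) v *\<^sub>R g x)" for v
      using Suc.prems C_k_Suc_imp_C_k[OF Suc.prems(1)] C_k_Suc_imp_C_k[OF Suc.prems(2)]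
      by (intro C_k_add Suc.IH) simp_all
  qed
qed (auto intro: continuous_intros)

lemma C_k_mult:
  fixes f g :: "'a::euclidean_space \<Rightarrow> real"
  shows "C_k k f \<Longrightarrow> C_k k g \<Longrightarrow> C_k k (\<lambda>x. f x * g x)"
  using C_k_scaleR[of k f g] by simp

lemma C_k_diff:
  assumes "C_k k f" "C_k k g"
  shows "C_k k (\<lambda>x. f x - g x)"
  using C_k_add[OF assms(1) C_k_scaleR[OF C_k_const[of k "-1"] assms(2)]] by simp

text \<open>The derivative of \<open>1 / f\<close> is built from \<open>1 / f\<close> and the
  derivative of \<open>f\<close>, so the induction closes. The minus sign is written as a constant
  factor so that \<open>C_k_mult\<close> covers it.\<close>

lemma C_k_inverse:
  fixes f :: "'a::euclidean_space \<Rightarrow> real"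
  assumes "\<And>x. f x \<noteq> 0"
  shows "C_k k f \<Longrightarrow> C_k k (\<lambda>x. inverse (f x))"
proof (induction k)
  case 0
  then show ?case
    using assms by (auto intro: continuous_intros)
next
  case (Suc k)
  show ?case
  proof (rule C_k_SucI)
    show "((\<lambda>x. inverse (f x)) has_derivative
        (\<lambda>v. (-1) * (inverse (f x) * frechet_derivative f (at x) v * inverse (f x)))) (at x)" for x
      using Deriv.has_derivative_inverse[OF assms C_k_Suc_has_derivative[OF Suc.prems]] by simp
    have "C_k k (\<lambda>x. inverse (f x))"
      using Suc.IH C_k_Suc_imp_C_k[OF Suc.prems] by blast
    then show "C_k k (\<lambda>x. (-1) * (inverse (f x) * frechet_derivative f (at x) v * inverse (f x)))" for v
      using Suc.prems by (intro C_k_mult C_k_const) simp_all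
  qed
qed

lemma C_k_sum:
  "(\<And>i. i \<in> I \<Longrightarrow> C_k k (f i)) \<Longrightarrow> C_k k (\<lambda>x. \<Sum>i\<in>I. f i x)"
  by (induction I rule: infinite_finite_induct) (auto intro: C_k_const C_k_add)

lemma C_k_prod:
  fixes f :: "'i \<Rightarrow> 'a::euclidean_space \<Rightarrow> real"
  shows "(\<And>i. i \<in> I \<Longrightarrow> C_k k (f i)) \<Longrightarrow> C_k k (\<lambda>x. \<Prod>i\<in>I. f i x)"
  by (induction I rule: infinite_finite_induct) (auto intro: C_k_const C_k_mult)

text \<open>The derivative in direction \<open>v\<close> is \<open>z \<mapsto> Dh(z)(L v)\<close>
  composed with the same affine map, so the statement reproduces itself one order lower.\<close>

lemma C_k_compose_affine:
  fixes L :: "'a::euclidean_space \<Rightarrow> 'b::euclidean_space"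
  assumes L: "bounded_linear L"
  shows "C_k k h \<Longrightarrow> C_k k (\<lambda>x. h (L x + b))"
proof (induction k arbitrary: h)
  case 0
  have "continuous_on UNIV (\<lambda>x. L x + b)"
    using linear_continuous_on[OF L] by (intro continuous_intros)
  with 0 show ?case
    using continuous_on_compose2[of UNIV h UNIV "\<lambda>x. L x + b"] by simp
next
  case (Suc k)
  show ?case
  proof (rule C_k_SucI)
    fix x
    have "((\<lambda>x. L x + b) has_derivative L) (at x)"
      using bounded_linear_imp_has_derivative[OF L] by (auto intro!: derivative_eq_intros)
    from has_derivative_compose[OF this C_k_Suc_has_derivative[OF Suc.prems]]
    show "((\<lambda>x. h (L x + b)) has_derivative (\<lambda>v. frechet_derivative h (at (L x + b)) (L v))) (at x)" .
  next
    show "C_k k (\<lambda>x. frechet_derivative h (at (L x + b)) (L v))" for v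
      using Suc.prems by (intro Suc.IH) simp
  qed
qed

text \<open>
  The functions \<open>p (1 / t) exp (- 1 / t)\<close>, extended by 0 to \<open>t \<le> 0\<close>, are closed under differentiation,
  which gives their smoothness without a formula for the higher derivatives.
\<close>

definition flat_exp :: "real poly \<Rightarrow> real \<Rightarrow> real" where
  "flat_exp p t = (if t > 0 then poly p (1 / t) * exp (- (1 / t)) else 0)"

text \<open>Substituting \<open>u = 1 / t\<close> reduces the limit to the decay of
  \<open>u ^ i / exp u\<close> at infinity for each monomial of \<open>p\<close>.\<close>

lemma flat_exp_tendsto_0: "(flat_exp p \<longlongrightarrow> 0) (at_right 0)"
proof -
  have "((\<lambda>u::real. \<Sum>i\<le>degree p. coeff p i * (u ^ i / exp u)) \<longlongrightarrow> (\<Sum>i\<le>degree p. coeff p i * 0)) at_top"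
    by (intro tendsto_intros tendsto_power_div_exp_0)
  then have "((\<lambda>u::real. poly p u * exp (- u)) \<longlongrightarrow> 0) at_top"
    by (simp add: poly_altdef sum_distrib_right exp_minus divide_inverse mult.assoc)
  then have "((\<lambda>t::real. poly p (inverse t) * exp (- inverse t)) \<longlongrightarrow> 0) (at_right 0)"
    by (rule filterlim_compose) (rule filterlim_inverse_at_top_right)
  moreover have "\<forall>\<^sub>F t in at_right 0. flat_exp p t = poly p (inverse t) * exp (- inverse t)"
    by (auto simp: flat_exp_def eventually_at_right_less divide_inverse eventually_at_filter)
  ultimately show ?thesis
    by (simp add: filterlim_cong)
qed

text \<open>The polynomial is \<open>X^2 (p - p')\<close>: the inner derivative of
  \<open>1 / t\<close> contributes \<open>X^2\<close>, the exponential gives \<open>p\<close> and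
  the polynomial factor gives \<open>- p'\<close>.\<close>

lemma flat_exp_has_derivative:
  "(flat_exp p has_real_derivative flat_exp ([:0, 0, 1:] * (p - pderiv p)) t) (at t)"
proof -
  consider "t < 0" | "t = 0" | "t > 0"
    by linarith
  then show ?thesis
  proof cases
    case 1
    have "((\<lambda>t. 0) has_real_derivative 0) (at t)"
      by simp
    then have "(flat_exp p has_real_derivative 0) (at t)"
      by (rule has_field_derivative_transform_within_open[where S="{..<0}"])
        (use 1 in \<open>auto simp: flat_exp_def\<close>)
    then show ?thesis
      using 1 by (simp add: flat_exp_def)
  next
    case 2
    \<comment> \<open>Dividing by \<open>h\<close> multiplies the polynomial by \<open>X\<close>, so
      the difference quotients at 0 are values of another member of the family. They vanish to the
      left of 0 and tend to 0 from the right.\<close>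
    have eq: "(flat_exp p (0 + h) - flat_exp p 0) / h = flat_exp (pCons 0 p) h" for h
      by (simp add: flat_exp_def)
    have "(flat_exp (pCons 0 p) \<longlongrightarrow> 0) (at_left 0)"
      by (rule tendsto_eventually) (auto simp: flat_exp_def eventually_at_filter)
    with flat_exp_tendsto_0 have "(flat_exp (pCons 0 p) \<longlongrightarrow> 0) (at 0)"
      by (simp add: filterlim_split_at)
    then have "(flat_exp p has_real_derivative 0) (at 0)"
      unfolding DERIV_def eq .
    then show ?thesis
      using 2 by (simp add: flat_exp_def)
  next
    case 3
    have "((\<lambda>t. poly p (1 / t) * exp (- (1 / t))) has_real_derivative
        flat_exp ([:0, 0, 1:] * (p - pderiv p)) t) (at t)"
      using 3 by (auto intro!: derivative_eq_intros DERIV_chain'[OF _ poly_DERIV]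
          simp: flat_exp_def field_simps power2_eq_square)
    then show ?thesis
      by (rule has_field_derivative_transform_within_open[where S="{0<..}"])
        (use 3 in \<open>auto simp: flat_exp_def\<close>)
  qed
qed

lemma C_k_flat_exp: "C_k k (flat_exp p)"
proof (induction k arbitrary: p)
  case 0
  then show ?case
    using flat_exp_has_derivative
    by (auto intro!: continuous_at_imp_continuous_on DERIV_isCont)
next
  case (Suc k)
  show ?case
  proof (rule C_k_SucI)
    show "(flat_exp p has_derivative (\<lambda>v. flat_exp ([:0, 0, 1:] * (p - pderiv p)) x * v)) (at x)" for x
      using flat_exp_has_derivative by (simp add: has_field_derivative_def)
    show "C_k k (\<lambda>x. flat_exp ([:0, 0, 1:] * (p - pderiv p)) x * v)" for v
      by (intro C_k_mult Suc.IH C_k_const)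
  qed
qed

text \<open>As \<open>flat_exp 1 t\<close> is \<open>exp (- 1 / t)\<close> for positive
  \<open>t\<close>, this is the usual smooth transition from 0 to 1 on the unit interval. The
  denominator is positive because \<open>t\<close> and \<open>1 - t\<close> are not both
  nonpositive.\<close>

definition smooth_step :: "real \<Rightarrow> real" where
  "smooth_step t = flat_exp 1 t * inverse (flat_exp 1 t + flat_exp 1 (1 - t))"

lemma smooth_step_denominator_pos: "flat_exp 1 t + flat_exp 1 (1 - t) > 0"
  by (auto simp: flat_exp_def add_pos_pos)

lemma smooth_step_eq_0: "t \<le> 0 \<Longrightarrow> smooth_step t = 0"
  and smooth_step_eq_1: "t \<ge> 1 \<Longrightarrow> smooth_step t = 1"
  by (auto simp: smooth_step_def flat_exp_def)

lemma smooth_step_nonneg: "smooth_step t \<ge> 0"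
  by (auto simp: smooth_step_def flat_exp_def)

lemma smooth_step_le_1: "smooth_step t \<le> 1"
  using smooth_step_denominator_pos[of t]
  by (auto simp: smooth_step_def flat_exp_def field_simps)

lemma C_k_smooth_step: "C_k k smooth_step"
proof -
  have "C_k k (\<lambda>t. flat_exp 1 (- t + 1))"
    using C_k_compose_affine[OF bounded_linear_minus[OF bounded_linear_ident] C_k_flat_exp] .
  then have "C_k k (\<lambda>t. flat_exp 1 t * inverse (flat_exp 1 t + flat_exp 1 (1 - t)))"
    using smooth_step_denominator_pos
    by (intro C_k_mult C_k_flat_exp C_k_inverse C_k_add)
      (auto simp: algebra_simps less_imp_neq[symmetric])
  then show ?thesis
    by (simp add: smooth_step_def[abs_def])
qed

text \<open>A bump written as a difference of consecutive translates, so that its integer translates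
  sum to 1 by telescoping.\<close>

definition hat :: "real \<Rightarrow> real" where
  "hat u = smooth_step (u + 1) - smooth_step u"

lemma hat_eq_0: "\<bar>u\<bar> \<ge> 1 \<Longrightarrow> hat u = 0"
  by (cases "u \<ge> 0") (auto simp: hat_def smooth_step_eq_0 smooth_step_eq_1)

lemma hat_nonneg: "hat u \<ge> 0"
  using smooth_step_nonneg[of "u + 1"] smooth_step_le_1[of u]
  by (cases "u \<ge> 0") (auto simp: hat_def smooth_step_eq_0 smooth_step_eq_1)

lemma C_k_hat: "C_k k hat"
  using C_k_diff[OF C_k_compose_affine[OF bounded_linear_ident C_k_smooth_step, of k 1] C_k_smooth_step]
  by (simp add: hat_def[abs_def])

lemma sum_hat:
  assumes "\<bar>t\<bar> \<le> real K"
  shows "(\<Sum>m\<in>{- int K..int K}. hat (t - of_int m)) = 1"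
proof -
  \<comment> \<open>Consecutive values of \<open>a\<close> differ by one translate of
    \<open>hat\<close>. At the two ends the arguments are \<open>t + K + 1 \<ge> 1\<close> and
    \<open>t - K \<le> 0\<close>, where the step equals 1 and 0.\<close>
  define a where "a i = smooth_step (t + K + 1 - real i)" for i
  have "(\<Sum>m\<in>{- int K..int K}. hat (t - of_int m)) = (\<Sum>i<2 * K + 1. a i - a (Suc i))"
    by (rule sum.reindex_bij_witness[of _ "\<lambda>i. int i - K" "\<lambda>m. nat (m + K)"])
      (auto simp: a_def hat_def algebra_simps)
  also have "\<dots> = a 0 - a (2 * K + 1)"
    by (rule sum_lessThan_telescope')
  also have "\<dots> = 1"
    using assms by (simp add: a_def smooth_step_eq_0 smooth_step_eq_1)
  finally show ?thesis .
qed

section \<open>Boundedness and Lipschitz continuity of functions with compact support\<close>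

lemma C_0_compact_support_bounded:
  assumes "continuous_on UNIV f" "compact (closure (support_on UNIV f))"
  obtains B where "B \<ge> 0" "\<And>x. norm (f x) \<le> B"
proof -
  let ?K = "closure (support_on UNIV f)"
  have "bounded (f ` ?K)"
    using assms by (intro compact_imp_bounded compact_continuous_image) (auto intro: continuous_on_subset)
  then obtain B where B: "\<And>x. x \<in> ?K \<Longrightarrow> norm (f x) \<le> B"
    by (auto simp: bounded_iff)
  have "norm (f x) \<le> max B 0" for x
    using B[of x] closure_subset[of "support_on UNIV f"]
    by (cases "f x = 0") (force simp: support_on_def)+
  then show thesis
    using that[of "max B 0"] by simp
qed

text \<open>Each directional derivative is continuous and vanishes off the support, hence is
  bounded. Finitely many basis directions then bound the operator norm of the derivative, and the
  mean value inequality applies.\<close>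

lemma C_1_compact_support_Lipschitz:
  fixes f :: "'a::euclidean_space \<Rightarrow> 'b::real_normed_vector"
  assumes f: "C_k 1 f" and K: "compact (closure (support_on UNIV f))"
  obtains L where "L \<ge> 0" "\<And>x y. norm (f x - f y) \<le> L * norm (x - y)"
proof -
  let ?D = "\<lambda>x. frechet_derivative f (at x)"
  have D: "(f has_derivative ?D x) (at x)" for x
    using f by (intro C_k_Suc_has_derivative[of 0]) simp
  have D0: "?D x v = 0" if "x \<notin> closure (support_on UNIV f)" for x v
  proof -
    have "(f has_derivative (\<lambda>v. 0)) (at x)"
      using that closure_subset[of "support_on UNIV f"]
      by (intro has_derivative_transform_within_open[OF has_derivative_const[of 0],
            where s="- closure (support_on UNIV f)"])
        (auto simp: support_on_def)
    then show ?thesis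
      using has_derivative_unique[OF D] by metis
  qed
  have "\<exists>B\<ge>0. \<forall>x. norm (?D x v) \<le> B" for v
  proof -
    have "continuous_on UNIV (\<lambda>x. ?D x v)"
      using f by simp
    moreover have "closure (support_on UNIV (\<lambda>x. ?D x v)) \<subseteq> closure (support_on UNIV f)"
      using D0 by (intro closure_minimal) (auto simp: support_on_def)
    then have "compact (closure (support_on UNIV (\<lambda>x. ?D x v)))"
      using compact_Int_closed[OF K closed_closure] by (metis inf.absorb2)
    ultimately show ?thesis
      using C_0_compact_support_bounded by metis
  qed
  then obtain B where B: "\<And>v. B v \<ge> 0" "\<And>x v. norm (?D x v) \<le> B v"
    by metis
  \<comment> \<open>The bounds \<open>B v\<close> depend on the direction \<open>v\<close>; summing
    over the basis makes them uniform on unit vectors.\<close>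
  define L where "L = (\<Sum>b\<in>Basis. B b)"
  have "L \<ge> 0"
    using B by (auto simp: L_def intro: sum_nonneg)
  moreover have "norm (?D x v) \<le> L * norm v" for x v
  proof -
    interpret bounded_linear "?D x"
      using D has_derivative_bounded_linear by blast
    have "?D x v = ?D x (\<Sum>b\<in>Basis. (v \<bullet> b) *\<^sub>R b)"
      by (simp add: euclidean_representation)
    also have "\<dots> = (\<Sum>b\<in>Basis. (v \<bullet> b) *\<^sub>R ?D x b)"
      by (simp add: sum scale)
    also have "norm \<dots> \<le> (\<Sum>b\<in>Basis. norm v * B b)"
      using B Basis_le_norm by (intro sum_norm_le) (auto intro!: mult_mono)
    finally show ?thesis
      by (simp add: L_def sum_distrib_left mult.commute)
  qed
  then have "norm (f x - f y) \<le> L * norm (x - y)" for x y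
    using D \<open>L \<ge> 0\<close>
    by (intro differentiable_bound[where S=UNIV and f'="?D"])
      (auto intro: onorm_bound has_derivative_at_withinI)
  ultimately show thesis
    using that by blast
qed

subsection \<open>Vanishing oscillation in terms of real inequalities\<close>

lemma tendsto_0_ennreal_iff:
  fixes h :: "'a \<Rightarrow> ennreal"
  shows "(h \<longlongrightarrow> 0) F \<longleftrightarrow> (\<forall>\<epsilon>>0. \<forall>\<^sub>F x in F. h x \<le> ennreal \<epsilon>)"
proof
  assume h: "(h \<longlongrightarrow> 0) F"
  show "\<forall>\<epsilon>>0. \<forall>\<^sub>F x in F. h x \<le> ennreal \<epsilon>"
  proof (intro allI impI)
    fix \<epsilon> :: real assume "\<epsilon> > 0"
    then have "\<forall>\<^sub>F x in F. h x < ennreal \<epsilon>"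
      using order_tendstoD(2)[OF h] by simp
    then show "\<forall>\<^sub>F x in F. h x \<le> ennreal \<epsilon>"
      by (rule eventually_mono) simp
  qed
next
  assume h: "\<forall>\<epsilon>>0. \<forall>\<^sub>F x in F. h x \<le> ennreal \<epsilon>"
  show "(h \<longlongrightarrow> 0) F"
  proof (rule order_tendstoI)
    fix a :: ennreal assume "0 < a"
    \<comment> \<open>\<open>a\<close> may be infinite. A value strictly between 0 and
      \<open>a\<close> is finite, hence of the form \<open>ennreal \<epsilon>\<close>.\<close>
    then obtain b where b: "0 < b" "b < a"
      using dense by blast
    then obtain \<epsilon> where "b = ennreal \<epsilon>" "\<epsilon> > 0"
      by (cases b) auto
    with h have "\<forall>\<^sub>F x in F. h x \<le> b"
      by blast
    then show "\<forall>\<^sub>F x in F. h x < a"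
      by (rule eventually_mono) (use b in auto)
  qed simp
qed

locale modulus =
  fixes \<omega> :: "real \<Rightarrow> real"
  assumes pos: "t > 0 \<Longrightarrow> \<omega> t > 0"
    and mono: "0 < s \<Longrightarrow> s \<le> t \<Longrightarrow> \<omega> s \<le> \<omega> t"
begin

text \<open>The predicate \<open>P\<close> covers the three suprema at once: all pairs, pairs at a
  fixed distance, and pairs far from the origin. Distinct points make the denominator positive, so
  that it can be cleared.\<close>

lemma SUP_osc_pair_le_iff:
  fixes f :: "'a::real_normed_vector \<Rightarrow> 'b::real_normed_vector"
  assumes "c \<ge> 0" and "\<And>x y. P x y \<Longrightarrow> x \<noteq> y"
  shows "(SUP (x, y) \<in> {(x, y). P x y}. ennreal (osc_pair \<omega> f x y)) \<le> ennreal c \<longleftrightarrow>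
    (\<forall>x y. P x y \<longrightarrow> norm (f x - f y) \<le> c * \<omega> (norm (x - y)))"
proof -
  have "ennreal (osc_pair \<omega> f x y) \<le> ennreal c \<longleftrightarrow> norm (f x - f y) \<le> c * \<omega> (norm (x - y))"
    if "P x y" for x y
    using assms(1) assms(2)[OF that] by (simp add: osc_pair_def pos_divide_le_eq pos)
  then show ?thesis
    by (auto simp: SUP_le_iff)
qed

lemma hoelder_seminorm_le_iff:
  "c \<ge> 0 \<Longrightarrow> hoelder_seminorm \<omega> f \<le> ennreal c \<longleftrightarrow>
    (\<forall>x y. x \<noteq> y \<longrightarrow> norm (f x - f y) \<le> c * \<omega> (norm (x - y)))"
  unfolding hoelder_seminorm_def by (rule SUP_osc_pair_le_iff)

lemma hoelder_space_iff:
  "f \<in> hoelder_space \<omega> \<longleftrightarrow>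
    (\<exists>c\<ge>0. \<forall>x y. x \<noteq> y \<longrightarrow> norm (f x - f y) \<le> c * \<omega> (norm (x - y)))"
proof -
  have "hoelder_seminorm \<omega> f < \<infinity> \<longleftrightarrow> (\<exists>c\<ge>0. hoelder_seminorm \<omega> f \<le> ennreal c)"
    by (cases "hoelder_seminorm \<omega> f") (auto simp: top_unique)
  then show ?thesis
    by (auto simp: hoelder_space_def hoelder_seminorm_le_iff)
qed

lemma osc_scale_le_iff:
  assumes "c \<ge> 0" "\<delta> > 0"
  shows "osc_scale \<omega> f \<delta> \<le> ennreal c \<longleftrightarrow>
    (\<forall>x y. norm (x - y) = \<delta> \<longrightarrow> norm (f x - f y) \<le> c * \<omega> (norm (x - y)))"
  unfolding osc_scale_def by (rule SUP_osc_pair_le_iff) (use assms in auto)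

lemma osc_far_le_iff:
  assumes "c \<ge> 0"
  shows "osc_far \<omega> f \<delta> \<le> ennreal c \<longleftrightarrow>
    (\<forall>x y. x \<noteq> y \<and> min (norm x) (norm y) > \<delta> \<longrightarrow> norm (f x - f y) \<le> c * \<omega> (norm (x - y)))"
  unfolding osc_far_def by (rule SUP_osc_pair_le_iff) (use assms in auto)

lemma VC_small_iff:
  "f \<in> VC_small \<omega> \<longleftrightarrow> f \<in> hoelder_space \<omega> \<and>
    (\<forall>\<epsilon>>0. \<exists>d>0. \<forall>x y. x \<noteq> y \<and> norm (x - y) < d \<longrightarrow> norm (f x - f y) \<le> \<epsilon> * \<omega> (norm (x - y)))"
proof -
  have "(\<forall>\<^sub>F \<delta> in at_right 0. osc_scale \<omega> f \<delta> \<le> ennreal \<epsilon>) \<longleftrightarrow>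
      (\<exists>d>0. \<forall>x y. x \<noteq> y \<and> norm (x - y) < d \<longrightarrow> norm (f x - f y) \<le> \<epsilon> * \<omega> (norm (x - y)))"
    if "\<epsilon> > 0" for \<epsilon>
    unfolding eventually_at_right_field using that by (auto simp: osc_scale_le_iff)
  then show ?thesis
    by (simp add: VC_small_def tendsto_0_ennreal_iff)
qed

lemma VC_large_iff:
  "f \<in> VC_large \<omega> \<longleftrightarrow> f \<in> hoelder_space \<omega> \<and>
    (\<forall>\<epsilon>>0. \<exists>T>0. \<forall>x y. norm (x - y) \<ge> T \<longrightarrow> norm (f x - f y) \<le> \<epsilon> * \<omega> (norm (x - y)))"
proof -
  have "(\<forall>\<^sub>F \<delta> in at_top. osc_scale \<omega> f \<delta> \<le> ennreal \<epsilon>) \<longleftrightarrow>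
      (\<exists>T>0. \<forall>x y. norm (x - y) \<ge> T \<longrightarrow> norm (f x - f y) \<le> \<epsilon> * \<omega> (norm (x - y)))" (is "?L \<longleftrightarrow> ?R")
    if "\<epsilon> > 0" for \<epsilon>
  proof
    assume ?L
    then obtain T where T: "\<And>\<delta>. \<delta> \<ge> T \<Longrightarrow> osc_scale \<omega> f \<delta> \<le> ennreal \<epsilon>"
      by (auto simp: eventually_at_top_linorder)
    \<comment> \<open>The threshold obtained from the filter may be nonpositive; the maximum with 1
      ensures a positive distance.\<close>
    have "norm (f x - f y) \<le> \<epsilon> * \<omega> (norm (x - y))" if "norm (x - y) \<ge> max T 1" for x y
    proof -
      have "norm (x - y) > 0"
        using that by linarith
      then show ?thesis
        using T[of "norm (x - y)"] osc_scale_le_iff[of \<epsilon> "norm (x - y)" f] that \<open>\<epsilon> > 0\<close> by simp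
    qed
    then show ?R
      by (intro exI[of _ "max T 1"]) auto
  next
    assume ?R
    then obtain T where "T > 0"
      "\<And>x y. norm (x - y) \<ge> T \<Longrightarrow> norm (f x - f y) \<le> \<epsilon> * \<omega> (norm (x - y))"
      by blast
    then have "\<forall>\<delta>\<ge>T. osc_scale \<omega> f \<delta> \<le> ennreal \<epsilon>"
      using that by (auto simp: osc_scale_le_iff)
    then show ?L
      unfolding eventually_at_top_linorder by blast
  qed
  then show ?thesis
    by (simp add: VC_large_def tendsto_0_ennreal_iff)
qed

text \<open>A bound beyond one threshold persists beyond every larger one, so holding eventually
  means holding for a single threshold.\<close>

lemma VC_far_iff:
  "f \<in> VC_far \<omega> \<longleftrightarrow> f \<in> hoelder_space \<omega> \<and>
    (\<forall>\<epsilon>>0. \<exists>T. \<forall>x y. x \<noteq> y \<and> norm x > T \<and> norm y > T \<longrightarrow>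
      norm (f x - f y) \<le> \<epsilon> * \<omega> (norm (x - y)))"
proof -
  have "(\<forall>\<^sub>F \<delta> in at_top. osc_far \<omega> f \<delta> \<le> ennreal \<epsilon>) \<longleftrightarrow>
      (\<exists>T. \<forall>x y. x \<noteq> y \<and> norm x > T \<and> norm y > T \<longrightarrow> norm (f x - f y) \<le> \<epsilon> * \<omega> (norm (x - y)))"
    if "\<epsilon> > 0" for \<epsilon>
    unfolding eventually_at_top_linorder using that
    by (simp add: osc_far_le_iff) (meson le_less_trans order_refl)
  then show ?thesis
    by (simp add: VC_far_def tendsto_0_ennreal_iff)
qed

text \<open>A convergent sequence is recovered from single approximants by choosing the
  \<open>k\<close>-th one with tolerance \<open>1 / (k + 1)\<close>.\<close>

lemma hoelder_closure_iff:
  "f \<in> hoelder_closure \<omega> \<C> \<longleftrightarrow> f \<in> hoelder_space \<omega> \<and>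
    (\<forall>\<epsilon>>0. \<exists>g\<in>\<C>. \<forall>x y. x \<noteq> y \<longrightarrow>
      norm ((g x - f x) - (g y - f y)) \<le> \<epsilon> * \<omega> (norm (x - y)))"
proof -
  let ?N = "\<lambda>g. hoelder_seminorm \<omega> (\<lambda>x. g x - f x)"
  have "(\<exists>g. (\<forall>k::nat. g k \<in> \<C>) \<and> (\<lambda>k. ?N (g k)) \<longlonglongrightarrow> 0) \<longleftrightarrow>
      (\<forall>\<epsilon>>0. \<exists>g\<in>\<C>. ?N g \<le> ennreal \<epsilon>)" (is "?L \<longleftrightarrow> ?R")
  proof
    assume ?L
    then show ?R
      unfolding tendsto_0_ennreal_iff eventually_sequentially by (meson order_refl)
  next
    assume R: ?R
    have "\<exists>g\<in>\<C>. ?N g \<le> ennreal (inverse (real (Suc k)))" for k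
      using R by simp
    then obtain g where g: "\<And>k. g k \<in> \<C>" "\<And>k. ?N (g k) \<le> ennreal (inverse (real (Suc k)))"
      by metis
    have lim: "(\<lambda>k. ennreal (inverse (real (Suc k)))) \<longlonglongrightarrow> 0"
      unfolding ennreal_0[symmetric] by (intro tendsto_ennrealI LIMSEQ_inverse_real_of_nat)
    have "(\<lambda>k. ?N (g k)) \<longlonglongrightarrow> 0"
    proof (rule tendsto_sandwich[OF always_eventually always_eventually tendsto_const lim])
      show "\<forall>k. ?N (g k) \<le> ennreal (inverse (real (Suc k)))"
        using g(2) by blast
    qed simp
    with g(1) show ?L
      by blast
  qed
  then show ?thesis
    by (simp add: hoelder_closure_def hoelder_seminorm_le_iff)
qed

lemma hoelder_closure_VC_subset:
  assumes "\<C> \<subseteq> (VC \<omega> :: ('a::real_normed_vector \<Rightarrow> 'b::real_normed_vector) set)"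
  shows "hoelder_closure \<omega> \<C> \<subseteq> VC \<omega>"
proof
  fix f :: "'a \<Rightarrow> 'b" assume f: "f \<in> hoelder_closure \<omega> \<C>"
  \<comment> \<open>Closeness is recorded pair by pair: a bound for \<open>g\<close> with constant
    \<open>\<epsilon> / 2\<close> at a pair gives one for \<open>f\<close> with constant
    \<open>\<epsilon>\<close> at the same pair. Each of the three vanishing conditions then passes
    from \<open>g\<close> to \<open>f\<close> with the same threshold.\<close>
  define close where "close \<epsilon> g \<longleftrightarrow> (\<forall>x y. x \<noteq> y \<longrightarrow>
      norm (g x - g y) \<le> \<epsilon> / 2 * \<omega> (norm (x - y)) \<longrightarrow> norm (f x - f y) \<le> \<epsilon> * \<omega> (norm (x - y)))"
    for \<epsilon> and g :: "'a \<Rightarrow> 'b"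
  have approx: "\<exists>g\<in>VC \<omega>. close \<epsilon> g" if \<epsilon>: "\<epsilon> > 0" for \<epsilon>
  proof -
    have "\<forall>\<epsilon>>0. \<exists>g\<in>\<C>. \<forall>x y. x \<noteq> y \<longrightarrow>
      norm ((g x - f x) - (g y - f y)) \<le> \<epsilon> * \<omega> (norm (x - y))"
      using f unfolding hoelder_closure_iff by blast
    from this[rule_format, OF half_gt_zero[OF \<epsilon>]] obtain g where g: "g \<in> \<C>"
      "\<And>x y. x \<noteq> y \<Longrightarrow> norm ((g x - f x) - (g y - f y)) \<le> \<epsilon> / 2 * \<omega> (norm (x - y))"
      by blast
    have "norm (f x - f y) \<le> \<epsilon> * \<omega> (norm (x - y))"
      if "x \<noteq> y" "norm (g x - g y) \<le> \<epsilon> / 2 * \<omega> (norm (x - y))" for x y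
    proof -
      have "norm (f x - f y) \<le> norm (g x - g y) + norm ((g x - f x) - (g y - f y))"
        using norm_triangle_ineq4[of "g x - g y" "(g x - f x) - (g y - f y)"]
        by (simp add: algebra_simps)
      with g(2)[OF that(1)] that(2) show ?thesis
        by simp
    qed
    with g(1) assms show ?thesis
      unfolding close_def by blast
  qed
  have "f \<in> hoelder_space \<omega>"
    using f by (simp add: hoelder_closure_iff)
  moreover have "\<exists>d>0. \<forall>x y. x \<noteq> y \<and> norm (x - y) < d \<longrightarrow> norm (f x - f y) \<le> \<epsilon> * \<omega> (norm (x - y))"
    if \<epsilon>: "\<epsilon> > 0" for \<epsilon>
  proof -
    obtain g where "g \<in> VC_small \<omega>" and g: "close \<epsilon> g"
      using approx[OF \<epsilon>] by (auto simp: VC_def)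
    then obtain d where "d > 0"
      "\<And>x y. x \<noteq> y \<Longrightarrow> norm (x - y) < d \<Longrightarrow> norm (g x - g y) \<le> \<epsilon> / 2 * \<omega> (norm (x - y))"
      using half_gt_zero[OF \<epsilon>] unfolding VC_small_iff by metis
    with g show ?thesis
      unfolding close_def by (intro exI[of _ d]) simp
  qed
  moreover have "\<exists>T>0. \<forall>x y. norm (x - y) \<ge> T \<longrightarrow> norm (f x - f y) \<le> \<epsilon> * \<omega> (norm (x - y))"
    if \<epsilon>: "\<epsilon> > 0" for \<epsilon>
  proof -
    obtain g where "g \<in> VC_large \<omega>" and g: "close \<epsilon> g"
      using approx[OF \<epsilon>] by (auto simp: VC_def)
    then obtain T where T: "T > 0"
      "\<And>x y. norm (x - y) \<ge> T \<Longrightarrow> norm (g x - g y) \<le> \<epsilon> / 2 * \<omega> (norm (x - y))"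
      using half_gt_zero[OF \<epsilon>] unfolding VC_large_iff by metis
    have "norm (f x - f y) \<le> \<epsilon> * \<omega> (norm (x - y))" if "norm (x - y) \<ge> T" for x y
    proof -
      have "x \<noteq> y"
        using that T(1) by auto
      with g T(2)[OF that] show ?thesis
        unfolding close_def by blast
    qed
    with T(1) show ?thesis
      by blast
  qed
  moreover have "\<exists>T. \<forall>x y. x \<noteq> y \<and> norm x > T \<and> norm y > T \<longrightarrow>
      norm (f x - f y) \<le> \<epsilon> * \<omega> (norm (x - y))"
    if \<epsilon>: "\<epsilon> > 0" for \<epsilon>
  proof -
    obtain g where "g \<in> VC_far \<omega>" and g: "close \<epsilon> g"
      using approx[OF \<epsilon>] by (auto simp: VC_def)
    then obtain T where "\<And>x y. x \<noteq> y \<Longrightarrow> norm x > T \<Longrightarrow> norm y > T \<Longrightarrow>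
        norm (g x - g y) \<le> \<epsilon> / 2 * \<omega> (norm (x - y))"
      using half_gt_zero[OF \<epsilon>] unfolding VC_far_iff by metis
    with g show ?thesis
      unfolding close_def by (intro exI[of _ T]) simp
  qed
  ultimately show "f \<in> VC \<omega>"
    by (simp add: VC_def VC_small_iff VC_large_iff VC_far_iff)
qed

end

text \<open>The segment from \<open>q\<close> to \<open>p\<close> is cut into equal steps of length
  at most \<open>t\<close>, which stay in \<open>S\<close> by convexity; their number, rounded up,
  is at most \<open>norm (p - q) / t + 1\<close>.\<close>

lemma norm_diff_le_chain:
  fixes f :: "'a::real_normed_vector \<Rightarrow> 'b::real_normed_vector"
  assumes "t > 0" "c \<ge> 0" "convex S" "p \<in> S" "q \<in> S"
    and step: "\<And>x y. x \<in> S \<Longrightarrow> y \<in> S \<Longrightarrow> norm (x - y) \<le> t \<Longrightarrow> norm (f x - f y) \<le> c"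
  shows "norm (f p - f q) \<le> (norm (p - q) / t + 1) * c"
proof (cases "p = q")
  case False
  define k where "k = nat \<lceil>norm (p - q) / t\<rceil>"
  have k: "k > 0" "norm (p - q) / t \<le> k" "k \<le> norm (p - q) / t + 1"
    using False \<open>t > 0\<close> by (auto simp: k_def)
  define P where "P i = (1 - real i / k) *\<^sub>R q + (real i / k) *\<^sub>R p" for i
  have "norm (f (P (Suc i)) - f (P i)) \<le> c" if "i < k" for i
  proof (rule step)
    have "P j \<in> S" if "j \<le> k" for j
      using that k assms unfolding P_def by (intro convexD) auto
    then show "P (Suc i) \<in> S" "P i \<in> S"
      using that by auto
    have "P (Suc i) - P i = (1 / k) *\<^sub>R (p - q)"
      by (simp add: P_def algebra_simps add_divide_distrib)
    then have "norm (P (Suc i) - P i) = norm (p - q) / k"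
      by simp
    also have "\<dots> \<le> t"
      using k \<open>t > 0\<close> by (simp add: field_simps)
    finally show "norm (P (Suc i) - P i) \<le> t" .
  qed
  then have "norm (\<Sum>i<k. f (P (Suc i)) - f (P i)) \<le> (\<Sum>i<k. c)"
    by (intro sum_norm_le) auto
  also have "(\<Sum>i<k. f (P (Suc i)) - f (P i)) = f p - f q"
    using k by (subst sum_lessThan_telescope) (simp add: P_def)
  also have "(\<Sum>i<k. c) \<le> (norm (p - q) / t + 1) * c"
    using k \<open>c \<ge> 0\<close> by (simp add: mult_right_mono)
  finally show ?thesis .
qed (use assms in simp)

section \<open>Asymptotics of the modulus, and smooth compactly supported functions as elements of
  \<open>VC\<close>\<close>

locale vanishing_modulus = modulus +
  assumes top: "filterlim \<omega> at_top at_top"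
    and small: "((\<lambda>t. t / \<omega> t) \<longlongrightarrow> 0) (at_right 0)"
begin

lemma le_modulus_small:
  assumes "c > 0"
  obtains d where "d > 0" "\<And>t. 0 < t \<Longrightarrow> t < d \<Longrightarrow> t \<le> c * \<omega> t"
proof -
  have "\<forall>\<^sub>F t in at_right 0. t / \<omega> t < c"
    using order_tendstoD(2)[OF small assms] .
  then obtain d where "d > 0" "\<And>t. 0 < t \<Longrightarrow> t < d \<Longrightarrow> t / \<omega> t < c"
    unfolding eventually_at_right_field by blast
  then show thesis
    using pos by (intro that[of d]) (auto simp: pos_divide_less_eq intro: less_imp_le)
qed

lemma modulus_large:
  obtains T where "T > 0" "\<And>t. t \<ge> T \<Longrightarrow> A \<le> \<omega> t"
proof -
  obtain T where T: "\<And>t. t \<ge> T \<Longrightarrow> A \<le> \<omega> t"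
    using top unfolding filterlim_at_top eventually_at_top_linorder by blast
  show thesis
    by (rule that[of "max T 1"]) (auto intro: T)
qed

text \<open>Small distances are handled by the Lipschitz bound and
  \<open>t / \<omega> t \<rightarrow> 0\<close>, large ones by boundedness and
  \<open>\<omega> t \<rightarrow> \<infinity>\<close>; pairs far from the origin lie outside the
  support.\<close>

lemma Cc_infinity_subset_VC: "Cc_infinity \<subseteq> VC \<omega>"
proof
  fix f :: "'a::euclidean_space \<Rightarrow> 'b::real_normed_vector"
  assume f: "f \<in> Cc_infinity"
  then have f_C: "C_k k f" and K: "compact (closure (support_on UNIV f))" for k
    by (auto simp: Cc_infinity_def)
  obtain B where B: "B \<ge> 0" "\<And>x. norm (f x) \<le> B"
    using C_0_compact_support_bounded K f_C[of 0] by (metis C_k.simps(1))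
  obtain L where L: "L \<ge> 0" "\<And>x y. norm (f x - f y) \<le> L * norm (x - y)"
    using C_1_compact_support_Lipschitz[OF f_C K] by metis
  have B2: "norm (f x - f y) \<le> 2 * B" for x y
    using norm_triangle_ineq4[of "f x" "f y"] B(2)[of x] B(2)[of y] by linarith
  have small': "\<exists>d>0. \<forall>x y. x \<noteq> y \<and> norm (x - y) < d \<longrightarrow> norm (f x - f y) \<le> \<epsilon> * \<omega> (norm (x - y))"
    if "\<epsilon> > 0" for \<epsilon>
  proof -
    \<comment> \<open>\<open>L\<close> may be 0, so \<open>L + 1\<close> serves as the
      divisor.\<close>
    have "\<epsilon> / (L + 1) > 0"
      using L that by simp
    then obtain d where d: "d > 0" "\<And>t. 0 < t \<Longrightarrow> t < d \<Longrightarrow> t \<le> \<epsilon> / (L + 1) * \<omega> t"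
      using le_modulus_small by blast
    have "norm (f x - f y) \<le> \<epsilon> * \<omega> (norm (x - y))" if "x \<noteq> y" "norm (x - y) < d" for x y
    proof -
      have "norm (f x - f y) \<le> (L + 1) * norm (x - y)"
        using L(2)[of x y] by (simp add: distrib_right add_increasing2)
      also have "\<dots> \<le> (L + 1) * (\<epsilon> / (L + 1) * \<omega> (norm (x - y)))"
        using d(2) that L by (intro mult_left_mono) auto
      finally show ?thesis
        using L by simp
    qed
    with d show ?thesis
      by blast
  qed
  obtain d where d: "d > 0"
    "\<And>x y. x \<noteq> y \<Longrightarrow> norm (x - y) < d \<Longrightarrow> norm (f x - f y) \<le> 1 * \<omega> (norm (x - y))"
    using small'[of 1] by auto
  \<comment> \<open>The summand 1 serves distances below \<open>d\<close>. From \<open>d\<close> on,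
    \<open>2 * B\<close> is at most \<open>2 * B / \<omega> d\<close> times the modulus, by
    monotonicity.\<close>
  have "norm (f x - f y) \<le> (1 + 2 * B / \<omega> d) * \<omega> (norm (x - y))" if "x \<noteq> y" for x y
  proof (cases "norm (x - y) < d")
    case True
    have "0 \<le> 2 * B / \<omega> d * \<omega> (norm (x - y))"
      using B d pos that by (simp add: less_imp_le)
    with d(2)[OF that True] show ?thesis
      by (simp add: distrib_right)
  next
    case False
    have "2 * B / \<omega> d * \<omega> d \<le> 2 * B / \<omega> d * \<omega> (norm (x - y))"
      using False d pos[of d] B by (intro mult_left_mono mono) auto
    moreover have "0 \<le> \<omega> (norm (x - y))"
      using that pos by (simp add: less_imp_le)
    ultimately show ?thesis
      using B2[of x y] pos[of d] d by (simp add: distrib_right)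
  qed
  moreover have "0 \<le> 1 + 2 * B / \<omega> d"
    using B d pos[of d] by (simp add: add_nonneg_nonneg)
  ultimately have "f \<in> hoelder_space \<omega>"
    unfolding hoelder_space_iff by blast
  moreover have "\<exists>T>0. \<forall>x y. norm (x - y) \<ge> T \<longrightarrow> norm (f x - f y) \<le> \<epsilon> * \<omega> (norm (x - y))"
    if "\<epsilon> > 0" for \<epsilon>
  proof -
    obtain T where T: "T > 0" "\<And>t. t \<ge> T \<Longrightarrow> 2 * B / \<epsilon> \<le> \<omega> t"
      using modulus_large by blast
    have "norm (f x - f y) \<le> \<epsilon> * \<omega> (norm (x - y))" if "norm (x - y) \<ge> T" for x y
    proof -
      have "2 * B \<le> \<epsilon> * \<omega> (norm (x - y))"
        using T(2)[OF that] \<open>\<epsilon> > 0\<close> by (simp add: pos_divide_le_eq mult.commute)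
      with B2 show ?thesis
        using order_trans by blast
    qed
    with T(1) show ?thesis
      by blast
  qed
  moreover have "\<exists>T. \<forall>x y. x \<noteq> y \<and> norm x > T \<and> norm y > T \<longrightarrow>
      norm (f x - f y) \<le> \<epsilon> * \<omega> (norm (x - y))" if "\<epsilon> > 0" for \<epsilon>
  proof -
    obtain T where T: "\<And>x. x \<in> closure (support_on UNIV f) \<Longrightarrow> norm x \<le> T"
      using compact_imp_bounded[OF K] by (auto simp: bounded_iff)
    have "f x = 0" if "norm x > T" for x
      using T[of x] closure_subset[of "support_on UNIV f"] that by (force simp: support_on_def)
    then show ?thesis
      using pos that by (intro exI[of _ T]) (auto simp: less_imp_le)
  qed
  ultimately show "f \<in> VC \<omega>"
    using small' by (simp add: VC_def VC_small_iff VC_large_iff VC_far_iff)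
qed

end

subsection \<open>Cutting off\<close>

context vanishing_modulus
begin

text \<open>This uniform lower bound lets a fixed constant be absorbed at every step length up to
  \<open>r\<close>. Three ranges of \<open>t\<close> are treated: near 0 the modulus dominates
  \<open>t\<close>, beyond \<open>T\<close> it exceeds \<open>A\<close>, and in between it is at
  least \<open>\<omega> d\<close> while \<open>r / t \<ge> r / T\<close>.\<close>

lemma modulus_scale_large:
  assumes "A \<ge> 0"
  obtains R where "R > 0" "\<And>r t. R \<le> r \<Longrightarrow> 0 < t \<Longrightarrow> t \<le> r \<Longrightarrow> A \<le> r / t * \<omega> t"
proof -
  obtain d where d: "d > 0" "\<And>t. 0 < t \<Longrightarrow> t < d \<Longrightarrow> t \<le> \<omega> t"
    using le_modulus_small[of 1] by auto
  obtain T where T: "T > 0" "\<And>t. t \<ge> T \<Longrightarrow> A \<le> \<omega> t"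
    using modulus_large by blast
  \<comment> \<open>The summand 1 gives positivity, \<open>A\<close> serves the range below
    \<open>d\<close>, and the last summand serves the middle range.\<close>
  define R where "R = 1 + A + A * T / \<omega> d"
  have "A * T / \<omega> d \<ge> 0"
    using assms T d pos[of d] by simp
  then have R: "R > 0" "R \<ge> A" "R \<ge> A * T / \<omega> d"
    using assms by (auto simp: R_def)
  have "A \<le> r / t * \<omega> t" if r: "R \<le> r" "0 < t" "t \<le> r" for r t
  proof -
    consider "t < d" | "t \<ge> T" | "d \<le> t" "t < T"
      by linarith
    then show ?thesis
    proof cases
      case 1
      have "A \<le> r / t * t"
        using r R by simp
      also have "\<dots> \<le> r / t * \<omega> t"
        using d(2)[OF r(2) 1] r by (intro mult_left_mono) auto
      finally show ?thesis .
    next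
      case 2
      have "A \<le> 1 * \<omega> t"
        using T 2 by simp
      also have "\<dots> \<le> r / t * \<omega> t"
        using r pos[of t] by (intro mult_right_mono) auto
      finally show ?thesis .
    next
      case 3
      have "A * T \<le> r * \<omega> d"
        using r R(3) pos[OF d(1)] by (simp add: pos_divide_le_eq) (meson mult_right_mono less_imp_le order_trans)
      then have "A \<le> r / T * \<omega> d"
        using T by (simp add: field_simps)
      also have "\<dots> \<le> r / t * \<omega> t"
        using r 3 d pos[of d] mono[of d t] by (intro mult_mono divide_left_mono) auto
      finally show ?thesis .
    qed
  qed
  with R(1) that show thesis
    by blast
qed

text \<open>The path from 0 to \<open>y\<close> first jumps to radius \<open>a\<close>, at a fixed
  cost, and then follows the ray through the region where the oscillation is small. The fixed cost
  is absorbed by taking \<open>R\<close> large.\<close>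

lemma radial_growth:
  fixes f :: "'a::real_normed_vector \<Rightarrow> 'b::real_normed_vector"
  assumes "M \<ge> 0" and M: "\<And>x y. x \<noteq> y \<Longrightarrow> norm (f x - f y) \<le> M * \<omega> (norm (x - y))"
    and "e > 0" "a > 0"
    and far: "\<And>x y. x \<noteq> y \<Longrightarrow> norm x \<ge> a \<Longrightarrow> norm y \<ge> a \<Longrightarrow> norm (f x - f y) \<le> e * \<omega> (norm (x - y))"
  obtains R where "R \<ge> a"
    "\<And>y t. norm y \<ge> R \<Longrightarrow> norm y \<le> 2 * R \<Longrightarrow> 0 < t \<Longrightarrow> t \<le> R \<Longrightarrow>
      norm (f y - f 0) \<le> 4 * e * (R / t * \<omega> t)"
proof -
  \<comment> \<open>Chosen so that \<open>e * A\<close> is the cost \<open>M * \<omega> a\<close> of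
    the jump from 0 to radius \<open>a\<close>.\<close>
  define A where "A = M * \<omega> a / e"
  have "A \<ge> 0"
    using assms pos[of a] by (simp add: A_def)
  then obtain R0 where R0: "\<And>r t. R0 \<le> r \<Longrightarrow> 0 < t \<Longrightarrow> t \<le> r \<Longrightarrow> A \<le> r / t * \<omega> t"
    using modulus_scale_large by blast
  define R where "R = max R0 a"
  have growth: "norm (f y - f 0) \<le> 4 * e * (R / t * \<omega> t)"
    if y: "norm y \<ge> R" "norm y \<le> 2 * R" and t: "0 < t" "t \<le> R" for y t
  proof -
    define u where "u = y /\<^sub>R norm y"
    have "norm y > 0"
      using y t by linarith
    then have u: "norm u = 1" "norm y *\<^sub>R u = y"
      by (auto simp: u_def)
    \<comment> \<open>The exterior of a ball need not be convex, so the chain runs over the radii in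
      a half-line instead of over points of the space.\<close>
    have "norm (f (norm y *\<^sub>R u) - f (a *\<^sub>R u)) \<le> (norm (norm y - a) / t + 1) * (e * \<omega> t)"
    proof (rule norm_diff_le_chain[where S="{a..}" and f="\<lambda>r. f (r *\<^sub>R u)"])
      fix r s :: real assume rs: "r \<in> {a..}" "s \<in> {a..}" "norm (r - s) \<le> t"
      show "norm (f (r *\<^sub>R u) - f (s *\<^sub>R u)) \<le> e * \<omega> t"
      proof (cases "r = s")
        case True
        then show ?thesis
          using \<open>e > 0\<close> pos[OF t(1)] by simp
      next
        case False
        have n: "norm (r *\<^sub>R u - s *\<^sub>R u) = \<bar>r - s\<bar>"
          using u by (simp flip: scaleR_left_diff_distrib)
        have "norm (f (r *\<^sub>R u) - f (s *\<^sub>R u)) \<le> e * \<omega> (norm (r *\<^sub>R u - s *\<^sub>R u))"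
          using False rs u \<open>a > 0\<close> n by (intro far) auto
        also have "\<dots> \<le> e * \<omega> t"
          using False rs \<open>e > 0\<close> by (intro mult_left_mono mono) (auto simp: n)
        finally show ?thesis .
      qed
    qed (use t y \<open>e > 0\<close> pos[of t] in \<open>auto simp: R_def\<close>)
    \<comment> \<open>Since \<open>t \<le> R\<close>, the extra step counts as at most
      \<open>R / t\<close>.\<close>
    also have "\<dots> \<le> (2 * R / t + R / t) * (e * \<omega> t)"
      using t y \<open>e > 0\<close> \<open>a > 0\<close> pos[of t]
      by (intro mult_right_mono add_mono divide_right_mono) (auto simp: R_def)
    also have "\<dots> = 3 * (e * (R / t * \<omega> t))"
      by (simp add: field_simps)
    finally have 1: "norm (f y - f (a *\<^sub>R u)) \<le> 3 * (e * (R / t * \<omega> t))"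
      using u by simp
    have "norm (f (a *\<^sub>R u) - f 0) \<le> M * \<omega> (norm (a *\<^sub>R u - 0))"
      using u \<open>a > 0\<close> by (intro M) auto
    also have "\<dots> = e * A"
      using u \<open>a > 0\<close> \<open>e > 0\<close> by (simp add: A_def)
    also have "\<dots> \<le> e * (R / t * \<omega> t)"
      using R0[of R t] t \<open>e > 0\<close> by (intro mult_left_mono) (auto simp: R_def)
    finally have 2: "norm (f (a *\<^sub>R u) - f 0) \<le> e * (R / t * \<omega> t)" .
    have "norm (f y - f 0) \<le> norm (f y - f (a *\<^sub>R u)) + norm (f (a *\<^sub>R u) - f 0)"
      using norm_triangle_ineq[of "f y - f (a *\<^sub>R u)" "f (a *\<^sub>R u) - f 0"] by simp
    also have "\<dots> \<le> 3 * (e * (R / t * \<omega> t)) + e * (R / t * \<omega> t)"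
      using 1 2 by (rule add_mono)
    also have "3 * r + r = 4 * r" for r :: real
      by simp
    finally show ?thesis
      by (simp only: mult.assoc)
  qed
  have "R \<ge> a"
    by (simp add: R_def)
  from this growth show thesis
    by (rule that)
qed

text \<open>The cut-off has slope \<open>1 / R\<close>, and this compensates the factor
  \<open>R / t\<close> in \<open>radial_growth\<close>. Subtracting \<open>f 0\<close> is free
  because the seminorm ignores constants.\<close>

lemma compact_support_approximation:
  fixes f :: "'a::real_normed_vector \<Rightarrow> 'b::real_normed_vector"
  assumes "f \<in> VC_far \<omega>" "\<epsilon> > 0"
  obtains F \<rho> where "\<And>x. norm x \<ge> \<rho> \<Longrightarrow> F x = 0"
    "\<And>x y. x \<noteq> y \<Longrightarrow> norm ((F x - f x) - (F y - f y)) \<le> \<epsilon> * \<omega> (norm (x - y))"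
proof -
  \<comment> \<open>One fifth pays for the oscillation of \<open>f\<close> far out, four fifths for
    the variation of the cut-off.\<close>
  define e where "e = \<epsilon> / 5"
  have "e > 0"
    using assms by (simp add: e_def)
  have VC: "f \<in> hoelder_space \<omega>" "\<forall>\<epsilon>>0. \<exists>T. \<forall>x y. x \<noteq> y \<and> norm x > T \<and> norm y > T \<longrightarrow>
      norm (f x - f y) \<le> \<epsilon> * \<omega> (norm (x - y))"
    using assms(1) by (simp_all add: VC_far_iff)
  obtain M where M: "M \<ge> 0" "\<And>x y. x \<noteq> y \<Longrightarrow> norm (f x - f y) \<le> M * \<omega> (norm (x - y))"
    using VC(1) unfolding hoelder_space_iff by metis
  obtain T where T: "\<And>x y. x \<noteq> y \<Longrightarrow> norm x > T \<Longrightarrow> norm y > T \<Longrightarrow>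
      norm (f x - f y) \<le> e * \<omega> (norm (x - y))"
    using VC(2) \<open>e > 0\<close> by metis
  define a where "a = max T 0 + 1"
  have "a > 0"
    by (simp add: a_def)
  have far: "norm (f x - f y) \<le> e * \<omega> (norm (x - y))"
    if "x \<noteq> y" "norm x \<ge> a" "norm y \<ge> a" for x y
    using that by (intro T) (auto simp: a_def)
  obtain R where "R \<ge> a" and R: "\<And>y t. norm y \<ge> R \<Longrightarrow> norm y \<le> 2 * R \<Longrightarrow> 0 < t \<Longrightarrow> t \<le> R \<Longrightarrow>
      norm (f y - f 0) \<le> 4 * e * (R / t * \<omega> t)"
    using radial_growth[OF M \<open>e > 0\<close> \<open>a > 0\<close> far] by metis
  have "R > 0"
    using \<open>R \<ge> a\<close> \<open>a > 0\<close> by simp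
  define \<psi> where "\<psi> x = max 0 (min 1 (2 - norm x / R))" for x :: 'a
  have \<psi>_01: "0 \<le> \<psi> x" "\<psi> x \<le> 1" for x
    by (auto simp: \<psi>_def)
  have \<psi>_1: "\<psi> x = 1" if "norm x \<le> R" for x
    using that \<open>R > 0\<close> by (simp add: \<psi>_def field_simps)
  have \<psi>_0: "\<psi> x = 0" if "norm x \<ge> 2 * R" for x
    using that \<open>R > 0\<close> by (simp add: \<psi>_def field_simps)
  have \<psi>_Lipschitz: "\<bar>\<psi> y - \<psi> x\<bar> \<le> norm (x - y) / R" for x y
  proof -
    have "\<bar>\<psi> y - \<psi> x\<bar> \<le> \<bar>norm x / R - norm y / R\<bar>"
      by (simp add: \<psi>_def)
    also have "\<dots> = \<bar>norm x - norm y\<bar> / R"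
      using \<open>R > 0\<close> by (simp flip: diff_divide_distrib)
    also have "\<dots> \<le> norm (x - y) / R"
      using \<open>R > 0\<close> norm_triangle_ineq3 by (intro divide_right_mono) auto
    finally show ?thesis .
  qed
  \<comment> \<open>Up to sign and an additive constant, \<open>h\<close> is the error
    \<open>F - f\<close>; it vanishes on the ball of radius \<open>R\<close>.\<close>
  define h where "h x = (1 - \<psi> x) *\<^sub>R (f x - f 0)" for x
  have outer: "norm (h x - h y) \<le> \<epsilon> * \<omega> (norm (x - y))"
    if xy: "x \<noteq> y" "norm y \<le> norm x" "norm y \<ge> R" for x y
  proof -
    have "norm ((1 - \<psi> x) *\<^sub>R (f x - f y)) \<le> 1 * (e * \<omega> (norm (x - y)))"
      unfolding norm_scaleR using \<psi>_01[of x] far[OF xy(1)] xy \<open>R \<ge> a\<close> by (intro mult_mono) auto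
    moreover have "norm ((\<psi> y - \<psi> x) *\<^sub>R (f y - f 0)) \<le> 4 * e * \<omega> (norm (x - y))"
    proof (cases "norm y \<ge> 2 * R")
      case True
      then show ?thesis
        using \<psi>_0[of x] \<psi>_0[of y] xy \<open>e > 0\<close> pos[of "norm (x - y)"] by simp
    next
      case False
      \<comment> \<open>Truncation at \<open>R\<close> keeps \<open>t\<close> in the range of
        \<open>radial_growth\<close>. The cut-off still varies by at most \<open>t / R\<close>,
        because it takes values between 0 and 1.\<close>
      define t where "t = min (norm (x - y)) R"
      have t: "0 < t" "t \<le> R" "t \<le> norm (x - y)"
        using xy \<open>R > 0\<close> by (auto simp: t_def)
      have "\<bar>\<psi> y - \<psi> x\<bar> \<le> t / R"
        using \<psi>_Lipschitz[of y x] \<psi>_01[of x] \<psi>_01[of y] \<open>R > 0\<close> by (auto simp: t_def min_def)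
      then have "norm ((\<psi> y - \<psi> x) *\<^sub>R (f y - f 0)) \<le> t / R * (4 * e * (R / t * \<omega> t))"
        unfolding norm_scaleR using R[of y t] xy False t \<open>R > 0\<close> by (intro mult_mono) auto
      also have "\<dots> = 4 * e * \<omega> t"
        using t \<open>R > 0\<close> by simp
      also have "\<dots> \<le> 4 * e * \<omega> (norm (x - y))"
        using t \<open>e > 0\<close> by (intro mult_left_mono mono) auto
      finally show ?thesis .
    qed
    \<comment> \<open>The variation of the cut-off is paired with the point \<open>y\<close> nearer
      the origin. It vanishes once \<open>y\<close> has norm at least \<open>2 * R\<close>, so
      \<open>f y\<close> is needed only in the shell covered by
      \<open>radial_growth\<close>.\<close>
    moreover have "h x - h y = (1 - \<psi> x) *\<^sub>R (f x - f y) + (\<psi> y - \<psi> x) *\<^sub>R (f y - f 0)"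
      by (simp add: h_def algebra_simps)
    ultimately show ?thesis
      using norm_triangle_ineq[of "(1 - \<psi> x) *\<^sub>R (f x - f y)" "(\<psi> y - \<psi> x) *\<^sub>R (f y - f 0)"]
      by (simp add: e_def)
  qed
  have ordered: "norm (h x - h y) \<le> \<epsilon> * \<omega> (norm (x - y))"
    if xy: "x \<noteq> y" "norm y \<le> norm x" for x y
  proof (cases "norm y < R")
    case True
    then have "h y = 0"
      by (simp add: h_def \<psi>_1)
    show ?thesis
    proof (cases "norm x \<le> R")
      case True
      then show ?thesis
        using \<open>h y = 0\<close> assms pos[of "norm (x - y)"] xy by (simp add: h_def \<psi>_1)
    next
      case False
      \<comment> \<open>\<open>z\<close> is the radial projection of \<open>x\<close> to the sphere
        of radius \<open>R\<close>, where \<open>h\<close> vanishes. As \<open>y\<close> lies inside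
        that sphere, \<open>z\<close> is no farther from \<open>x\<close> than \<open>y\<close>
        is.\<close>
      define z where "z = (R / norm x) *\<^sub>R x"
      have z: "norm z = R" "h z = 0"
        using False \<open>R > 0\<close> by (auto simp: z_def h_def \<psi>_1)
      have "x - z = (1 - R / norm x) *\<^sub>R x"
        by (simp add: z_def algebra_simps)
      moreover have "R / norm x \<le> 1" "norm x \<noteq> 0"
        using False \<open>R > 0\<close> by (auto simp: divide_le_eq_1)
      ultimately have xz: "norm (x - z) = norm x - R"
        by (simp add: left_diff_distrib)
      have "norm (h x - h y) = norm (h x - h z)"
        using z \<open>h y = 0\<close> by simp
      also have "\<dots> \<le> \<epsilon> * \<omega> (norm (x - z))"
        using False z by (intro outer) auto
      also have "\<dots> \<le> \<epsilon> * \<omega> (norm (x - y))"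
        using False True assms norm_triangle_ineq2[of x y]
        by (intro mult_left_mono mono) (auto simp: xz)
      finally show ?thesis .
    qed
  qed (use outer xy in auto)
  define F where "F x = \<psi> x *\<^sub>R (f x - f 0)" for x
  show thesis
  proof (rule that)
    show "F x = 0" if "norm x \<ge> 2 * R" for x
      using that by (simp add: F_def \<psi>_0)
    show "norm ((F x - f x) - (F y - f y)) \<le> \<epsilon> * \<omega> (norm (x - y))" if "x \<noteq> y" for x y
    proof -
      have "(F x - f x) - (F y - f y) = h y - h x"
        by (simp add: F_def h_def algebra_simps)
      then show ?thesis
        using ordered[of x y] ordered[of y x] that by (simp add: norm_minus_commute) (meson linear)
    qed
  qed
qed

end

subsection \<open>Smoothing on a lattice\<close>

definition lattice_point :: "('n::finite \<Rightarrow> int) \<Rightarrow> real ^ 'n" where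
  "lattice_point j = (\<chi> i. of_int (j i))"

definition lattice_box :: "nat \<Rightarrow> ('n::finite \<Rightarrow> int) set" where
  "lattice_box K = PiE UNIV (\<lambda>_. {- int K..int K})"

definition tensor_hat :: "real ^ 'n::finite \<Rightarrow> real" where
  "tensor_hat u = (\<Prod>i\<in>UNIV. hat (u $ i))"

lemma finite_lattice_box: "finite (lattice_box K)"
  unfolding lattice_box_def by (intro finite_PiE) auto

lemma lattice_box_iff: "j \<in> lattice_box K \<longleftrightarrow> (\<forall>i. \<bar>j i\<bar> \<le> int K)"
proof -
  have "- int K \<le> m \<and> m \<le> int K \<longleftrightarrow> \<bar>m\<bar> \<le> int K" for m
    by linarith
  then show ?thesis
    by (simp add: lattice_box_def PiE_iff)
qed

lemma lattice_box_mono: "K \<le> K' \<Longrightarrow> lattice_box K \<subseteq> lattice_box K'"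
  unfolding lattice_box_def by (intro PiE_mono) auto

lemma tensor_hat_nonneg: "tensor_hat u \<ge> 0"
  unfolding tensor_hat_def by (intro prod_nonneg) (simp add: hat_nonneg)

lemma tensor_hat_nonzeroD:
  assumes "tensor_hat u \<noteq> 0"
  shows "\<bar>u $ i\<bar> < 1"
proof (rule ccontr)
  assume "\<not> ?thesis"
  then have "hat (u $ i) = 0"
    by (intro hat_eq_0) auto
  with assms show False
    unfolding tensor_hat_def by (metis UNIV_I finite prod_zero_iff)
qed

lemma norm_le_card_mult:
  fixes u :: "real ^ 'n::finite" and c :: real
  assumes "\<And>i. \<bar>u $ i\<bar> \<le> c"
  shows "norm u \<le> real CARD('n) * c"
  using norm_le_l1_cart[of u] sum_bounded_above[of UNIV "\<lambda>i. \<bar>u $ i\<bar>" c] assms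
  by (meson order_trans UNIV_I)

text \<open>Distributivity turns the sum over the box into a product of one-dimensional sums, each
  equal to 1.\<close>

lemma sum_tensor_hat:
  assumes "\<And>i. \<bar>u $ i\<bar> \<le> real K"
  shows "(\<Sum>j\<in>lattice_box K. tensor_hat (u - lattice_point j)) = 1"
proof -
  have "(\<Sum>j\<in>lattice_box K. tensor_hat (u - lattice_point j)) =
      (\<Prod>i\<in>UNIV. \<Sum>m\<in>{- int K..int K}. hat (u $ i - of_int m))"
    unfolding lattice_box_def tensor_hat_def lattice_point_def
    by (subst prod_sum_PiE) auto
  also have "\<dots> = 1"
    using sum_hat assms by (intro prod.neutral) auto
  finally show ?thesis .
qed

text \<open>Each coordinate leaves four integers. The bound is 2 and not 1 so that it also covers
  lattice points active at a second point less than one unit away from \<open>u\<close>.\<close>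

lemma card_near_lattice_points:
  fixes u :: "real ^ 'n::finite" and J :: "('n \<Rightarrow> int) set"
  assumes "\<And>j i. j \<in> J \<Longrightarrow> \<bar>(u - lattice_point j) $ i\<bar> < 2"
  shows "card J \<le> 4 ^ CARD('n)"
proof -
  have "J \<subseteq> PiE UNIV (\<lambda>i. {\<lfloor>u $ i\<rfloor> - 1..\<lfloor>u $ i\<rfloor> + 2})"
  proof
    fix j assume "j \<in> J"
    have "\<lfloor>u $ i\<rfloor> - 1 \<le> j i \<and> j i \<le> \<lfloor>u $ i\<rfloor> + 2" for i
    proof -
      have "\<bar>u $ i - of_int (j i)\<bar> < 2"
        using assms[OF \<open>j \<in> J\<close>, of i] by (simp add: lattice_point_def)
      then show ?thesis
        by linarith
    qed
    then show "j \<in> PiE UNIV (\<lambda>i. {\<lfloor>u $ i\<rfloor> - 1..\<lfloor>u $ i\<rfloor> + 2})"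
      by auto
  qed
  then have "card J \<le> card (PiE UNIV (\<lambda>i. {\<lfloor>u $ i\<rfloor> - 1..\<lfloor>u $ i\<rfloor> + 2}))"
    by (intro card_mono finite_PiE) auto
  also have "\<dots> = 4 ^ CARD('n)"
    by (simp add: card_PiE)
  finally show ?thesis .
qed

lemma C_k_tensor_hat: "C_k k (tensor_hat :: real ^ 'n::finite \<Rightarrow> real)"
proof -
  have "C_k k (\<lambda>u :: real ^ 'n. hat (u $ i + 0))" for i
    by (intro C_k_compose_affine bounded_linear_vec_nth C_k_hat)
  then show ?thesis
    unfolding tensor_hat_def[abs_def] by (intro C_k_prod) simp
qed

lemma tensor_hat_Lipschitz:
  obtains L where "L \<ge> 0"
    "\<And>u v :: real ^ 'n::finite. \<bar>tensor_hat u - tensor_hat v\<bar> \<le> L * norm (u - v)"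
proof -
  let ?\<Phi> = "tensor_hat :: real ^ 'n \<Rightarrow> real"
  have "support_on UNIV ?\<Phi> \<subseteq> cball 0 (real CARD('n) * 1)"
  proof
    fix u assume "u \<in> support_on UNIV ?\<Phi>"
    then have "\<bar>u $ i\<bar> \<le> 1" for i
      using tensor_hat_nonzeroD[of u i] by (simp add: support_on_def)
    then have "norm u \<le> real CARD('n) * 1"
      by (rule norm_le_card_mult)
    then show "u \<in> cball 0 (real CARD('n) * 1)"
      by simp
  qed
  then have "bounded (support_on UNIV ?\<Phi>)"
    by (rule bounded_subset[OF bounded_cball])
  then have supp: "compact (closure (support_on UNIV ?\<Phi>))"
    by simp
  show thesis
  proof (rule C_1_compact_support_Lipschitz[OF C_k_tensor_hat supp])
    fix L assume "L \<ge> 0" "\<And>u v. norm (?\<Phi> u - ?\<Phi> v) \<le> L * norm (u - v)"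
    then show thesis
      unfolding real_norm_def by (rule that)
  qed
qed

context modulus
begin

text \<open>The constant depends on the dimension and \<open>L\<close> alone, not on
  \<open>\<eta>\<close> or \<open>\<rho>\<close>. At distances below \<open>\<eta>\<close> the
  oscillations of \<open>g\<close> and \<open>F\<close> are bounded separately; at larger ones
  \<open>g\<close> and \<open>F\<close> are compared at each of the two points.\<close>

lemma smooth_approximation:
  fixes F :: "real ^ 'n::finite \<Rightarrow> 'b::real_normed_vector"
  assumes L: "L \<ge> 0" "\<And>u v :: real ^ 'n. \<bar>tensor_hat u - tensor_hat v\<bar> \<le> L * norm (u - v)"
    and "\<eta> > 0" "e \<ge> 0"
    and F: "\<And>x y. x \<noteq> y \<Longrightarrow> norm (x - y) \<le> \<eta> \<Longrightarrow> norm (F x - F y) \<le> e * \<omega> (norm (x - y))"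
    and supp: "\<And>x. norm x \<ge> \<rho> \<Longrightarrow> F x = 0"
  defines "D \<equiv> real CARD('n)"
  shows "\<exists>g\<in>Cc_infinity. \<forall>x y. x \<noteq> y \<longrightarrow>
    norm ((g x - F x) - (g y - F y)) \<le> (2 * (D + 1) + 4 ^ CARD('n) * L * (2 * D + 1) + 1) * e * \<omega> (norm (x - y))"
proof -
  have chain: "norm (F x - F y) \<le> (norm (x - y) / t + 1) * (e * \<omega> t)" if t: "0 < t" "t \<le> \<eta>" for x y t
  proof (rule norm_diff_le_chain[where S=UNIV])
    show "norm (F x - F y) \<le> e * \<omega> t" if "norm (x - y) \<le> t" for x y
    proof (cases "x = y")
      case False
      then have "norm (F x - F y) \<le> e * \<omega> (norm (x - y))"
        using that t by (intro F) auto
      also have "\<dots> \<le> e * \<omega> t"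
        using False that \<open>e \<ge> 0\<close> by (intro mult_left_mono mono) auto
      finally show ?thesis .
    qed (use \<open>e \<ge> 0\<close> pos[OF t(1)] in simp)
  qed (use t \<open>e \<ge> 0\<close> pos[OF t(1)] in auto)
  define a :: "('n \<Rightarrow> int) \<Rightarrow> real ^ 'n" where "a j = \<eta> *\<^sub>R lattice_point j" for j
  define \<Phi> where "\<Phi> j x = tensor_hat (inverse \<eta> *\<^sub>R x - lattice_point j)" for j and x :: "real ^ 'n"
  have scaled: "norm (x - a j) = \<eta> * norm (inverse \<eta> *\<^sub>R x - lattice_point j)" for x j
  proof -
    have "x - a j = \<eta> *\<^sub>R (inverse \<eta> *\<^sub>R x - lattice_point j)"
      using \<open>\<eta> > 0\<close> by (simp add: a_def algebra_simps)
    then show ?thesis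
      using \<open>\<eta> > 0\<close> by simp
  qed
  have \<Phi>_Lipschitz: "\<bar>\<Phi> j x - \<Phi> j y\<bar> \<le> L * (norm (x - y) / \<eta>)" for j x y
    using L(2)[of "inverse \<eta> *\<^sub>R x - lattice_point j" "inverse \<eta> *\<^sub>R y - lattice_point j"] \<open>\<eta> > 0\<close>
    by (simp add: \<Phi>_def divide_inverse mult.commute flip: scaleR_diff_right)
  have near: "norm (x - a j) \<le> D * \<eta>" if "\<Phi> j x \<noteq> 0" for j x
    using tensor_hat_nonzeroD[OF that[unfolded \<Phi>_def]] \<open>\<eta> > 0\<close>
      norm_le_card_mult[of "inverse \<eta> *\<^sub>R x - lattice_point j" 1]
    by (simp add: scaled D_def less_imp_le mult.commute)
  have "\<exists>K::nat. \<forall>i. \<bar>(inverse \<eta> *\<^sub>R x) $ i\<bar> \<le> real K" for x :: "real ^ 'n"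
  proof -
    obtain K :: nat where "norm (inverse \<eta> *\<^sub>R x) \<le> real K"
      using real_arch_simple by blast
    then show ?thesis
      using component_le_norm_cart order_trans by blast
  qed
  then obtain k :: "real ^ 'n \<Rightarrow> nat" where k: "\<And>x i. \<bar>(inverse \<eta> *\<^sub>R x) $ i\<bar> \<le> real (k x)"
    by metis
  obtain K :: nat where K: "\<rho> / \<eta> \<le> real K"
    using real_arch_simple by blast
  define g where "g x = (\<Sum>j\<in>lattice_box K. \<Phi> j x *\<^sub>R F (a j))" for x
  have F_outside: "F (a j) = 0" if out: "j \<notin> lattice_box K" for j
  proof (rule supp)
    obtain i where i: "\<bar>j i\<bar> > int K"
      using out unfolding lattice_box_iff by (metis not_le)
    have "\<rho> \<le> \<eta> * real K"
      using K \<open>\<eta> > 0\<close> by (simp add: pos_divide_le_eq mult.commute)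
    also have "\<dots> \<le> \<eta> * \<bar>real_of_int (j i)\<bar>"
      using i \<open>\<eta> > 0\<close> by (intro mult_left_mono) linarith+
    also have "\<dots> = \<bar>a j $ i\<bar>"
      using \<open>\<eta> > 0\<close> by (simp add: a_def lattice_point_def abs_mult)
    also have "\<dots> \<le> norm (a j)"
      by (rule component_le_norm_cart)
    finally show "\<rho> \<le> norm (a j)" .
  qed
  \<comment> \<open>The partition of unity sums to 1 at \<open>x\<close> only over a box depending
    on \<open>x\<close>. Enlarging the box leaves \<open>g\<close> unchanged, because
    \<open>F\<close> vanishes at the added nodes.\<close>
  have g_eq: "g x = (\<Sum>j\<in>lattice_box K'. \<Phi> j x *\<^sub>R F (a j))" if "K \<le> K'" for K' x
    unfolding g_def
  proof (rule sum.mono_neutral_left)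
    show "lattice_box K \<subseteq> lattice_box K'"
      using that by (rule lattice_box_mono)
  qed (auto simp: finite_lattice_box F_outside)
  have sum_\<Phi>: "(\<Sum>j\<in>lattice_box K'. \<Phi> j x) = 1" if "k x \<le> K'" for K' x
  proof -
    have "\<bar>(inverse \<eta> *\<^sub>R x) $ i\<bar> \<le> real K'" for i
      using k[of x i] that by linarith
    then show ?thesis
      unfolding \<Phi>_def by (rule sum_tensor_hat)
  qed
  \<comment> \<open>\<open>g x\<close> is a weighted mean of values of \<open>F\<close> at nodes
    within \<open>D * \<eta>\<close> of \<open>x\<close>, which chaining with steps of length
    \<open>\<eta>\<close> compares with \<open>F x\<close>.\<close>
  have g_F: "norm (g x - F x) \<le> (D + 1) * e * \<omega> \<eta>" for x
  proof -
    define K' where "K' = max K (k x)"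
    have "g x - F x = (\<Sum>j\<in>lattice_box K'. \<Phi> j x *\<^sub>R F (a j)) - (\<Sum>j\<in>lattice_box K'. \<Phi> j x) *\<^sub>R F x"
      by (simp add: g_eq[of K'] sum_\<Phi> K'_def)
    also have "\<dots> = (\<Sum>j\<in>lattice_box K'. \<Phi> j x *\<^sub>R (F (a j) - F x))"
      by (simp add: scaleR_sum_left scaleR_diff_right sum_subtractf)
    also have "norm \<dots> \<le> (\<Sum>j\<in>lattice_box K'. \<Phi> j x * ((D + 1) * e * \<omega> \<eta>))"
    proof (rule sum_norm_le)
      fix j
      show "norm (\<Phi> j x *\<^sub>R (F (a j) - F x)) \<le> \<Phi> j x * ((D + 1) * e * \<omega> \<eta>)"
      proof (cases "\<Phi> j x = 0")
        case False
        have "norm (F (a j) - F x) \<le> (norm (a j - x) / \<eta> + 1) * (e * \<omega> \<eta>)"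
          using \<open>\<eta> > 0\<close> by (intro chain) auto
        also have "\<dots> \<le> (D + 1) * (e * \<omega> \<eta>)"
          using near[OF False] \<open>\<eta> > 0\<close> \<open>e \<ge> 0\<close> pos[of \<eta>]
          by (intro mult_right_mono) (auto simp: pos_divide_le_eq norm_minus_commute)
        finally show ?thesis
          by (simp add: \<Phi>_def tensor_hat_nonneg mult_left_mono mult.assoc)
      qed simp
    qed
    also have "\<dots> = (D + 1) * e * \<omega> \<eta>"
      using sum_\<Phi>[of x K'] by (simp add: K'_def flip: sum_distrib_right)
    finally show ?thesis .
  qed
  have g_Lipschitz: "norm (g x - g y) \<le> 4 ^ CARD('n) * L * (2 * D + 1) * e * \<omega> (norm (x - y))"
    if xy: "x \<noteq> y" "norm (x - y) < \<eta>" for x y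
  proof -
    define t where "t = norm (x - y)"
    have t: "0 < t" "t < \<eta>"
      using xy by (auto simp: t_def)
    define K' where "K' = max K (max (k x) (k y))"
    define J where "J = {j \<in> lattice_box K'. \<Phi> j x \<noteq> 0 \<or> \<Phi> j y \<noteq> 0}"
    have J: "\<bar>(inverse \<eta> *\<^sub>R x - lattice_point j) $ i\<bar> < 2" if "j \<in> J" for j i
    proof -
      have "\<bar>(inverse \<eta> *\<^sub>R x - inverse \<eta> *\<^sub>R y) $ i\<bar> \<le> norm (inverse \<eta> *\<^sub>R (x - y))"
        unfolding scaleR_diff_right by (rule component_le_norm_cart)
      also have "\<dots> = t / \<eta>"
        using \<open>\<eta> > 0\<close> unfolding norm_scaleR by (simp add: t_def divide_inverse mult.commute)
      also have "\<dots> < 1"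
        using t by simp
      finally have "\<bar>(inverse \<eta> *\<^sub>R x) $ i - (inverse \<eta> *\<^sub>R y) $ i\<bar> < 1"
        by simp
      moreover have "\<bar>(inverse \<eta> *\<^sub>R x) $ i - lattice_point j $ i\<bar> < 1 \<or>
          \<bar>(inverse \<eta> *\<^sub>R y) $ i - lattice_point j $ i\<bar> < 1"
        using that unfolding J_def \<Phi>_def by (auto dest!: tensor_hat_nonzeroD[of _ i])
      ultimately show ?thesis
        unfolding vector_minus_component by linarith
    qed
    \<comment> \<open>The subtracted term is 0, both sums being 1. It replaces
      \<open>F (a j)\<close> by \<open>F (a j) - F x\<close>, which is small at active
      nodes.\<close>
    have "g x - g y = (\<Sum>j\<in>lattice_box K'. (\<Phi> j x - \<Phi> j y) *\<^sub>R F (a j))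
        - ((\<Sum>j\<in>lattice_box K'. \<Phi> j x) - (\<Sum>j\<in>lattice_box K'. \<Phi> j y)) *\<^sub>R F x"
      by (simp add: g_eq[of K'] sum_\<Phi> K'_def scaleR_diff_left sum_subtractf)
    also have "\<dots> = (\<Sum>j\<in>lattice_box K'. (\<Phi> j x - \<Phi> j y) *\<^sub>R (F (a j) - F x))"
      by (simp add: scaleR_sum_left scaleR_diff_left scaleR_diff_right sum_subtractf)
    also have "\<dots> = (\<Sum>j\<in>J. (\<Phi> j x - \<Phi> j y) *\<^sub>R (F (a j) - F x))"
      by (rule sum.mono_neutral_right) (auto simp: J_def finite_lattice_box)
    also have "norm \<dots> \<le> (\<Sum>j\<in>J. L * (2 * D + 1) * e * \<omega> t)"
    proof (rule sum_norm_le)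
      fix j assume "j \<in> J"
      then have "norm (x - a j) \<le> 2 * D * \<eta>"
        using norm_le_card_mult[of "inverse \<eta> *\<^sub>R x - lattice_point j" 2] J \<open>\<eta> > 0\<close>
        by (simp add: scaled D_def less_imp_le mult.commute)
      \<comment> \<open>Since \<open>t < \<eta>\<close>, the bound is a multiple of
        \<open>\<eta> / t\<close>, which cancels the factor \<open>t / \<eta>\<close> from the
        Lipschitz estimate of \<open>\<Phi>\<close>.\<close>
      then have "norm (a j - x) / t + 1 \<le> 2 * D * \<eta> / t + \<eta> / t"
        using t by (intro add_mono divide_right_mono) (auto simp: norm_minus_commute)
      then have "(norm (a j - x) / t + 1) * (e * \<omega> t) \<le> (2 * D * \<eta> / t + \<eta> / t) * (e * \<omega> t)"
        using \<open>e \<ge> 0\<close> pos[OF t(1)] by (intro mult_right_mono) auto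
      with chain[OF t(1) less_imp_le[OF t(2)]]
      have "norm (F (a j) - F x) \<le> (2 * D * \<eta> / t + \<eta> / t) * (e * \<omega> t)"
        by (rule order_trans)
      moreover have "0 \<le> L * (t / \<eta>)"
        using L(1) t \<open>\<eta> > 0\<close> by simp
      ultimately have "norm ((\<Phi> j x - \<Phi> j y) *\<^sub>R (F (a j) - F x)) \<le>
          L * (t / \<eta>) * ((2 * D * \<eta> / t + \<eta> / t) * (e * \<omega> t))"
        unfolding norm_scaleR real_norm_def t_def by (intro mult_mono \<Phi>_Lipschitz norm_ge_zero)
      also have "\<dots> = L * (2 * D + 1) * e * \<omega> t"
        using t \<open>\<eta> > 0\<close> by (simp add: field_simps)
      finally show "norm ((\<Phi> j x - \<Phi> j y) *\<^sub>R (F (a j) - F x)) \<le> L * (2 * D + 1) * e * \<omega> t" .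
    qed
    also have "\<dots> = real (card J) * (L * (2 * D + 1) * e * \<omega> t)"
      by (rule sum_constant)
    also have "\<dots> \<le> 4 ^ CARD('n) * (L * (2 * D + 1) * e * \<omega> t)"
    proof (rule mult_right_mono)
      show "real (card J) \<le> 4 ^ CARD('n)"
        using of_nat_mono[OF card_near_lattice_points[of J, OF J], where 'a=real] by simp
    qed (use L(1) \<open>e \<ge> 0\<close> pos[OF t(1)] in \<open>simp add: D_def\<close>)
    finally show ?thesis
      by (simp add: t_def mult.assoc)
  qed
  have "C_k m g" for m
  proof -
    have "C_k m (\<lambda>x. \<Phi> j x)" for j
      using C_k_compose_affine[OF bounded_linear_scaleR_right C_k_tensor_hat, of m "inverse \<eta>" "- lattice_point j"]
      by (simp add: \<Phi>_def)
    then show ?thesis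
      unfolding g_def[abs_def] by (intro C_k_sum C_k_scaleR C_k_const)
  qed
  moreover have "support_on UNIV g \<subseteq> (\<Union>j\<in>lattice_box K. cball (a j) (D * \<eta>))"
  proof
    fix x assume "x \<in> support_on UNIV g"
    then have "g x \<noteq> 0"
      by (simp add: support_on_def)
    then obtain j where "j \<in> lattice_box K" "\<Phi> j x \<noteq> 0"
      unfolding g_def by (metis (no_types, lifting) scaleR_eq_0_iff sum.neutral)
    with near show "x \<in> (\<Union>j\<in>lattice_box K. cball (a j) (D * \<eta>))"
      by (auto simp: dist_norm norm_minus_commute)
  qed
  then have "bounded (support_on UNIV g)"
    by (rule bounded_subset[rotated]) (auto intro: bounded_UN finite_lattice_box)
  then have "compact (closure (support_on UNIV g))"
    by simp
  ultimately have "g \<in> Cc_infinity"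
    by (simp add: Cc_infinity_def)
  moreover have "norm ((g x - F x) - (g y - F y)) \<le>
      (2 * (D + 1) + 4 ^ CARD('n) * L * (2 * D + 1) + 1) * e * \<omega> (norm (x - y))" if "x \<noteq> y" for x y
  proof -
    define w where "w = e * \<omega> (norm (x - y))"
    define c where "c = 4 ^ CARD('n) * L * (2 * D + 1)"
    have w: "w \<ge> 0" and c: "c \<ge> 0"
      using that \<open>e \<ge> 0\<close> pos[of "norm (x - y)"] L(1) by (auto simp: w_def c_def D_def)
    have D: "D \<ge> 0"
      by (simp add: D_def)
    have "norm ((g x - F x) - (g y - F y)) \<le> (2 * (D + 1) + c + 1) * w"
    proof (cases "norm (x - y) < \<eta>")
      case True
      have "norm ((g x - F x) - (g y - F y)) \<le> norm (g x - g y) + norm (F x - F y)"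
        using norm_triangle_ineq4[of "g x - g y" "F x - F y"] by (simp add: algebra_simps)
      also have "\<dots> \<le> c * w + w"
        using g_Lipschitz[OF that True] F[OF that] True by (simp add: w_def c_def mult.assoc)
      also have "\<dots> \<le> (2 * (D + 1) + c + 1) * w"
        using w D by (simp add: distrib_right)
      finally show ?thesis .
    next
      case False
      have "norm ((g x - F x) - (g y - F y)) \<le> norm (g x - F x) + norm (g y - F y)"
        by (rule norm_triangle_ineq4)
      also have "\<dots> \<le> (D + 1) * (e * \<omega> \<eta>) + (D + 1) * (e * \<omega> \<eta>)"
        using g_F[of x] g_F[of y] unfolding mult.assoc by (rule add_mono)
      also have "\<dots> \<le> (D + 1) * w + (D + 1) * w"
        unfolding w_def using False \<open>\<eta> > 0\<close> \<open>e \<ge> 0\<close> D by (intro add_mono mult_left_mono mono) auto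
      also have "\<dots> \<le> (2 * (D + 1) + c + 1) * w"
        using w c by (simp add: distrib_right)
      finally show ?thesis .
    qed
    then show ?thesis
      by (simp add: w_def c_def mult.assoc)
  qed
  ultimately show ?thesis
    by blast
qed

end

section \<open>Cut-off and smoothing combined\<close>

context vanishing_modulus
begin

lemma VC_subset_closure:
  "(VC \<omega> :: (real ^ 'n::finite \<Rightarrow> 'b::real_normed_vector) set) \<subseteq> hoelder_closure \<omega> Cc_infinity"
proof
  fix f :: "real ^ 'n \<Rightarrow> 'b" assume f: "f \<in> VC \<omega>"
  then have "f \<in> VC_small \<omega>" and VC_far: "f \<in> VC_far \<omega>"
    by (auto simp: VC_def)
  then have VC: "f \<in> hoelder_space \<omega>" "\<forall>\<epsilon>>0. \<exists>d>0. \<forall>x y. x \<noteq> y \<and> norm (x - y) < d \<longrightarrow>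
      norm (f x - f y) \<le> \<epsilon> * \<omega> (norm (x - y))"
    by (simp_all add: VC_small_iff)
  obtain L where L: "L \<ge> 0" "\<And>u v :: real ^ 'n. \<bar>tensor_hat u - tensor_hat v\<bar> \<le> L * norm (u - v)"
    using tensor_hat_Lipschitz by blast
  define C where "C = 2 * (real CARD('n) + 1) + 4 ^ CARD('n) * L * (2 * real CARD('n) + 1) + 1"
  have "C \<ge> 0"
    using L(1) by (simp add: C_def)
  have "\<exists>g\<in>Cc_infinity. \<forall>x y. x \<noteq> y \<longrightarrow>
      norm ((g x - f x) - (g y - f y)) \<le> \<epsilon> * \<omega> (norm (x - y))" if "\<epsilon> > 0" for \<epsilon>
  proof -
    \<comment> \<open>Cutting off costs \<open>e\<close> and smoothing costs
      \<open>C * (2 * e)\<close>, since \<open>F\<close> inherits oscillation \<open>e\<close> from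
      \<open>f\<close> and \<open>e\<close> from the cut-off error.\<close>
    define e where "e = \<epsilon> / (2 * C + 1)"
    have "e > 0"
      using that \<open>C \<ge> 0\<close> by (simp add: e_def)
    obtain F \<rho> where supp: "\<And>x. norm x \<ge> \<rho> \<Longrightarrow> F x = 0"
      and F: "\<And>x y. x \<noteq> y \<Longrightarrow> norm ((F x - f x) - (F y - f y)) \<le> e * \<omega> (norm (x - y))"
      by (rule compact_support_approximation[OF VC_far \<open>e > 0\<close>]) (rule that)
    obtain d where "d > 0"
      and d: "\<And>x y. x \<noteq> y \<Longrightarrow> norm (x - y) < d \<Longrightarrow> norm (f x - f y) \<le> e * \<omega> (norm (x - y))"
      using VC(2) \<open>e > 0\<close> by metis
    \<comment> \<open>Halving \<open>d\<close> passes from a strict to a non-strict bound on the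
      distance, as the smoothing step requires with \<open>\<eta> = d / 2\<close>.\<close>
    have F_small: "norm (F x - F y) \<le> (2 * e) * \<omega> (norm (x - y))"
      if "x \<noteq> y" "norm (x - y) \<le> d / 2" for x y
    proof -
      have "norm (F x - F y) \<le> norm ((F x - f x) - (F y - f y)) + norm (f x - f y)"
        using norm_triangle_ineq[of "(F x - f x) - (F y - f y)" "f x - f y"] by simp
      also have "\<dots> \<le> e * \<omega> (norm (x - y)) + e * \<omega> (norm (x - y))"
        using that \<open>d > 0\<close> by (intro add_mono F d) auto
      finally show ?thesis
        by simp
    qed
    have "d / 2 > 0" "2 * e \<ge> 0"
      using \<open>d > 0\<close> \<open>e > 0\<close> by auto
    then have "\<exists>g\<in>Cc_infinity. \<forall>x y. x \<noteq> y \<longrightarrow>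
        norm ((g x - F x) - (g y - F y)) \<le> C * (2 * e) * \<omega> (norm (x - y))"
      unfolding C_def by (rule smooth_approximation[OF L]) (erule (1) F_small, erule supp)
    then obtain g where "g \<in> Cc_infinity"
      and g: "\<forall>x y. x \<noteq> y \<longrightarrow> norm ((g x - F x) - (g y - F y)) \<le> C * (2 * e) * \<omega> (norm (x - y))"
      by (elim bexE)
    have "norm ((g x - f x) - (g y - f y)) \<le> \<epsilon> * \<omega> (norm (x - y))" if "x \<noteq> y" for x y
    proof -
      have "norm ((g x - f x) - (g y - f y)) \<le>
          norm ((g x - F x) - (g y - F y)) + norm ((F x - f x) - (F y - f y))"
        using norm_triangle_ineq[of "(g x - F x) - (g y - F y)" "(F x - f x) - (F y - f y)"]
        by (simp add: algebra_simps)
      also have "\<dots> \<le> C * (2 * e) * \<omega> (norm (x - y)) + e * \<omega> (norm (x - y))"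
        using that by (intro add_mono g[rule_format] F)
      also have "\<dots> = (2 * C + 1) * e * \<omega> (norm (x - y))"
        by (simp add: algebra_simps)
      also have "(2 * C + 1) * e = \<epsilon>"
        using \<open>C \<ge> 0\<close> by (simp add: e_def)
      finally show ?thesis .
    qed
    with \<open>g \<in> Cc_infinity\<close> show ?thesis
      by blast
  qed
  with VC(1) show "f \<in> hoelder_closure \<omega> Cc_infinity"
    by (simp add: hoelder_closure_iff)
qed

end

theorem theorem1p6:
  fixes \<omega> :: "real \<Rightarrow> real" and Cdb :: real
  assumes "\<And>t. t > 0 \<Longrightarrow> \<omega> t > 0"
    and "mono_on {0<..} \<omega>"
    and "(\<omega> \<longlongrightarrow> 0) (at_right 0)"
    and "filterlim \<omega> at_top at_top"
    and "((\<lambda>t. t / \<omega> t) \<longlongrightarrow> 0) (at_right 0)"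
    and "Cdb > 1"
    and "\<And>t. t > 0 \<Longrightarrow> \<omega> (2 * t) \<le> Cdb * \<omega> t"
  shows "(VC \<omega> :: (real ^ 'n \<Rightarrow> 'y::banach) set) = hoelder_closure \<omega> Cc_infinity"
proof -
  interpret vanishing_modulus \<omega>
  proof
    show "\<omega> s \<le> \<omega> t" if "0 < s" "s \<le> t" for s t
      using mono_onD[OF assms(2), of s t] that by simp
  qed (use assms in auto)
  show ?thesis
    using VC_subset_closure hoelder_closure_VC_subset[OF Cc_infinity_subset_VC] by blast
qed

end
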